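(* Let $a,b\ge1$ be integers, let $\xi_n^{a,b}:=1-ab/n$ for $n>ab$, and define $$\phi(\alpha)=\frac{(\alpha/e)^{\alpha}}{\Gamma(\alpha)},\qquad \Phi(\alpha,\varepsilon)=\frac{(\alpha/e)^{\alpha}}{\Gamma(\alpha)}\int_{-\varepsilon}^{\varepsilon}(1+s)^{\alpha-1}e^{-\alpha s}\,\mathrm{d}s,$$ $$\psi(a,b)=\tfrac12L\ell(\ell+1)-\tfrac16(\ell^3-\ell),\qquad L=\max(a,b),\ \ell=\min(a,b).$$ (1) Exact size. For $n>ab$ let $\textsc{SamplePartitions}_{a,b}[n]$ be the procedure that repeatedly and independently runs the sampler $\Gamma M_{a,b}(\xi_n^{a,b})$ until the generated diagram has size exactly $n$, and then applies Pak's transform to that diagram. Then $\textsc{SamplePartitions}_{a,b}[n]$ is an exact-size sampler for $(a\times b)$-boxed plane partitions, i.e. its output is a uniformly random $(a\times b)$-boxed plane partition of size $n$, and, for fixed $(a,b)$, its expected running time is asymptotically equivalent to $\dfrac{ab}{\phi(ab)}\,n$ as $n\to\infty$. (2) Approximate size. For $n>ab$ and $\varepsilon\in(0,1)$ let $\textsc{SamplePartitions}_{a,b}[n,\varepsilon]$ be the procedure that repeatedly and independently runs $\Gamma M_{a,b}(\xi_n^{a,b})$ until the generated diagram has size in $[n(1-\varepsilon),n(1+\varepsilon)]$, and then applies Pak's transform to that diagram. Then $\textsc{SamplePartitions}_{a,b}[n,\varepsilon]$ is an approximate-size sampler for $(a\times b)$-boxed plane partitions, i.e. its output is a random $(a\times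 b)$-boxed plane partition of size in $[n(1-\varepsilon),n(1+\varepsilon)]$ such that any two such partitions of the same size have the same probability of being output; and, for fixed $(a,b,\varepsilon)$, its expected running time converges to the constant $\psi(a,b)+ab/\Phi(ab,\varepsilon)$ as $n\to\infty$.
   Context: $\mathbb{N}=\{0,1,2,\dots\}$. A plane partition is an array $(a_{i,j})_{(i,j)\in\mathbb{N}^2}$ of nonnegative integers with finitely many nonzero entries such that $a_{i,j}\ge a_{i,j+1}$ and $a_{i,j}\ge a_{i+1,j}$ for all $i,j$; its size is $\sum_{i,j}a_{i,j}$. It is $(a\times b)$-boxed if $a_{i,j}=0$ whenever $i\ge a$ or $j\ge b$. A diagram is an array $D=(D[i,j])_{(i,j)\in\mathbb{N}^2}$ of nonnegative integers with finitely many nonzero entries; its size is $|D|=\sum_{i,j}D[i,j](i+j+1)$. The bounding rectangle of $D$ is the smallest $[0..\ell-1]\times[0..w-1]$ outside of which $D$ vanishes. Pak's transform of a diagram $D$ with bounding rectangle $[0..\ell-1]\times[0..w-1]$: for $i=\ell-1$ down to $0$, and for each such $i$, for $j=w-1$ down to $0$, do: (1) $D[i,j]\leftarrow D[i,j]+\max(D[i+1,j],D[i,j+1])$; (2) for $c=1,\dots,\min(\ell-1-i,\,w-1-j)$, with $p=i+c$, $q=j+c$, set $D[p,q]\leftarrow\max(D[p+1,q],D[p,q+1])+\min(D[p-1,q],D[p,q-1])-D[p,q]$. Return $D$. Sampler $\Gamma M_{a,b}(x)$, $0<x<1$: for all $0\le i<a$, $0\le j<b$, independently draw $D[i,j]$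 from the geometric law $\mathbb{P}(k)=p^k(1-p)$, $k\ge0$, with $p=x^{i+j+1}$; all other entries of $D$ are $0$; return $D$. Cost model: each draw from a geometric law has cost $1$ (so each run of $\Gamma M_{a,b}(x)$ costs $ab$), each assignment to an array entry in Pak's transform (in steps (1) and (2)) has cost $1$, and nothing else is charged. The running time is the total cost. Here $\Gamma(\alpha)$ in the formulas for $\phi,\Phi$ is the Euler Gamma function. *)

theory Defs
  imports "HOL-Probability.Probability" "HOL-Library.Landau_Symbols"
begin

type_synonym array = "nat \<times> nat \<Rightarrow> nat"

definition plane_partition :: "array \<Rightarrow> bool" where
  "plane_partition \<pi> \<longleftrightarrow> finite {c. \<pi> c \<noteq> 0} \<and>
     (\<forall>i j. \<pi> (i, j + 1) \<le> \<pi> (i, j) \<and> \<pi> (i + 1, j) \<le> \<pi> (i, j))"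

definition partition_size :: "array \<Rightarrow> nat" where
  "partition_size \<pi> = (\<Sum>c | \<pi> c \<noteq> 0. \<pi> c)"

definition boxed :: "nat \<Rightarrow> nat \<Rightarrow> array \<Rightarrow> bool" where
  "boxed a b \<pi> \<longleftrightarrow> (\<forall>i j. a \<le> i \<or> b \<le> j \<longrightarrow> \<pi> (i, j) = 0)"

definition boxed_plane_partitions :: "nat \<Rightarrow> nat \<Rightarrow> array set" where
  "boxed_plane_partitions a b = {\<pi>. plane_partition \<pi> \<and> boxed a b \<pi>}"

definition diagram_size :: "array \<Rightarrow> nat" where
  "diagram_size D = (\<Sum>(i, j) | D (i, j) \<noteq> 0. D (i, j) * (i + j + 1))"

text \<open>Dimensions of the bounding rectangle; both are 0 for the zero diagram.\<close>

definition bounding_length :: "array \<Rightarrow> nat" where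
  "bounding_length D = (LEAST l. \<forall>i j. l \<le> i \<longrightarrow> D (i, j) = 0)"

definition bounding_width :: "array \<Rightarrow> nat" where
  "bounding_width D = (LEAST w. \<forall>i j. w \<le> j \<longrightarrow> D (i, j) = 0)"

text \<open>
  Pak's transform runs on a state consisting of the array and a counter of the assignments made
  so far. The subtraction on natural numbers in \<open>pak_toggle\<close> never truncates during a run of the
  transform: the entries treated so far are weakly decreasing along rows and columns, so the
  subtracted entry is at most the minimum.
\<close>

definition assign :: "nat \<times> nat \<Rightarrow> nat \<Rightarrow> array \<times> nat \<Rightarrow> array \<times> nat" where
  "assign c v = (\<lambda>(D, t). (D(c := v), t + 1))"

definition pak_add :: "nat \<Rightarrow> nat \<Rightarrow> array \<times> nat \<Rightarrow> array \<times> nat" where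
  "pak_add i j S = (let D = fst S in
     assign (i, j) (D (i, j) + max (D (i + 1, j)) (D (i, j + 1))) S)"

definition pak_toggle :: "nat \<Rightarrow> nat \<Rightarrow> nat \<Rightarrow> array \<times> nat \<Rightarrow> array \<times> nat" where
  "pak_toggle i j c S = (let D = fst S; p = i + c; q = j + c in
     assign (p, q)
       (max (D (p + 1, q)) (D (p, q + 1)) + min (D (p - 1, q)) (D (p, q - 1)) - D (p, q)) S)"

definition pak_cell :: "nat \<Rightarrow> nat \<Rightarrow> nat \<Rightarrow> nat \<Rightarrow> array \<times> nat \<Rightarrow> array \<times> nat" where
  "pak_cell l w i j S = fold (pak_toggle i j) [1..<min (l - 1 - i) (w - 1 - j) + 1] (pak_add i j S)"

definition pak_transform :: "array \<Rightarrow> array \<times> nat" where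
  "pak_transform D = (let l = bounding_length D; w = bounding_width D in
     fold (\<lambda>i. fold (\<lambda>j. pak_cell l w i j) (rev [0..<w])) (rev [0..<l]) (D, 0))"

text \<open>
  Randomised procedures return their output together with the cost incurred.
  The library's \<open>geometric_pmf p\<close> has success probability \<open>p\<close>, giving \<open>k\<close> the mass
  \<open>(1 - p) ^ k * p\<close>.
\<close>

definition gamma_M :: "nat \<Rightarrow> nat \<Rightarrow> real \<Rightarrow> (array \<times> nat) pmf" where
  "gamma_M a b x = map_pmf (\<lambda>D. (D, a * b))
     (Pi_pmf ({..<a} \<times> {..<b}) 0 (\<lambda>(i, j). geometric_pmf (1 - x ^ (i + j + 1))))"

partial_function (spmf) repeat_until ::
    "('d \<times> nat) pmf \<Rightarrow> ('d \<Rightarrow> bool) \<Rightarrow> ('d \<times> nat) spmf" where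
  "repeat_until M P = bind_spmf (spmf_of_pmf M) (\<lambda>(D, t).
     if P D then return_spmf (D, t)
     else map_spmf (\<lambda>(D', t'). (D', t + t')) (repeat_until M P))"

definition sample_partitions ::
    "nat \<Rightarrow> nat \<Rightarrow> real \<Rightarrow> (nat \<Rightarrow> bool) \<Rightarrow> (array \<times> nat) spmf" where
  "sample_partitions a b x P =
     map_spmf (\<lambda>(D, t). case pak_transform D of (\<pi>, u) \<Rightarrow> (\<pi>, t + u))
       (repeat_until (gamma_M a b x) (\<lambda>D. P (diagram_size D)))"

definition xi :: "nat \<Rightarrow> nat \<Rightarrow> nat \<Rightarrow> real" where
  "xi a b n = 1 - real (a * b) / real n"

definition size_window :: "nat \<Rightarrow> real \<Rightarrow> real set" where
  "size_window n \<epsilon> = {real n * (1 - \<epsilon>)..real n * (1 + \<epsilon>)}"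

definition sample_exact :: "nat \<Rightarrow> nat \<Rightarrow> nat \<Rightarrow> (array \<times> nat) spmf" where
  "sample_exact a b n = sample_partitions a b (xi a b n) (\<lambda>m. m = n)"

definition sample_approx :: "nat \<Rightarrow> nat \<Rightarrow> nat \<Rightarrow> real \<Rightarrow> (array \<times> nat) spmf" where
  "sample_approx a b n \<epsilon> = sample_partitions a b (xi a b n) (\<lambda>m. real m \<in> size_window n \<epsilon>)"

definition output_distribution :: "(array \<times> nat) spmf \<Rightarrow> array spmf" where
  "output_distribution = map_spmf fst"

text \<open>
  Meaningful when the procedure terminates almost surely and the cost is integrable; the
  Bochner integral is 0 for a non-integrable cost.
\<close>

definition expected_cost :: "(array \<times> nat) spmf \<Rightarrow> real" where
  "expected_cost p = (\<integral>r. real (snd r) \<partial>measure_spmf p)"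

definition finite_expected_cost :: "(array \<times> nat) spmf \<Rightarrow> bool" where
  "finite_expected_cost p \<longleftrightarrow> integrable (measure_spmf p) (\<lambda>r. real (snd r))"

definition exact_size_sampler :: "nat \<Rightarrow> nat \<Rightarrow> nat \<Rightarrow> array spmf \<Rightarrow> bool" where
  "exact_size_sampler a b n p \<longleftrightarrow> lossless_spmf p \<and>
     p = spmf_of_set {\<pi> \<in> boxed_plane_partitions a b. partition_size \<pi> = n}"

definition approx_size_sampler :: "nat \<Rightarrow> nat \<Rightarrow> nat \<Rightarrow> real \<Rightarrow> array spmf \<Rightarrow> bool" where
  "approx_size_sampler a b n \<epsilon> p \<longleftrightarrow>
     (let A = {\<pi> \<in> boxed_plane_partitions a b. real (partition_size \<pi>) \<in> size_window n \<epsilon>} in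
       lossless_spmf p \<and> set_spmf p \<subseteq> A \<and>
       (\<forall>\<pi>\<in>A. \<forall>\<rho>\<in>A. partition_size \<pi> = partition_size \<rho> \<longrightarrow> spmf p \<pi> = spmf p \<rho>))"

definition phi :: "real \<Rightarrow> real" where
  "phi \<alpha> = (\<alpha> / exp 1) powr \<alpha> / Gamma \<alpha>"

definition Phi :: "real \<Rightarrow> real \<Rightarrow> real" where
  "Phi \<alpha> \<epsilon> = (\<alpha> / exp 1) powr \<alpha> / Gamma \<alpha> *
     integral {-\<epsilon>..\<epsilon>} (\<lambda>s. (1 + s) powr (\<alpha> - 1) * exp (- \<alpha> * s))"

definition psi :: "nat \<Rightarrow> nat \<Rightarrow> real" where
  "psi a b = (let L = real (max a b); l = real (min a b) in
     1 / 2 * L * l * (l + 1) - 1 / 6 * (l ^ 3 - l))"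

end

theory Submission
  imports Defs
begin

text \<open>
  In Pak's transform the cells are processed in an order in which the region already treated is
  closed under moving down and right. Processing a cell adds the larger of its lower and right
  neighbours and toggles the entries further along its diagonal; the toggles only read the two
  adjacent diagonals, so each step is invertible, and it keeps the treated region weakly
  decreasing. Since \<open>max x y + min x y = x + y\<close>, the sum along a diagonal obeys the
  inclusion-exclusion recursion of the rectangular sums of the original diagram, and adding up
  these rectangles counts the entry \<open>(i, j)\<close> exactly \<open>i + j + 1\<close> times. Hence the
  transform is a size-preserving bijection onto boxed plane partitions.

  The sampler gives a diagram of size \<open>m\<close> the mass \<open>x ^ m\<close> times a constant, so conditioning on
  the size yields a uniform law, and rejection costs \<open>a b\<close> per trial for a geometric number of
  trials. The number of diagrams of size \<open>m\<close> is asymptotic to a constant times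
  \<open>m ^ (a b - 1)\<close>; with \<open>x = 1 - a b / n\<close> this gives a local limit law for the size on the
  scale \<open>n\<close>, which dominated convergence turns into the limit for the window.
\<close>

section \<open>The steps of the transform\<close>

text \<open>The imperative transform runs over the bounding rectangle of its input, which varies
  with the diagram, so it is not visibly a single map. A step at a cell outside that rectangle
  changes nothing, hence for a diagram in the \<open>a\<close> by \<open>b\<close> box the run may
  be extended to the full box, where bijectivity is a statement about one fixed list of steps. Only
  the number of assignments still sees the rectangle. It never exceeds \<open>psi a b\<close>, with
  equality when the corner entry \<open>D (a - 1, b - 1)\<close> is nonzero. For exact size it is
  negligible against the order \<open>n\<close> cost of rejection; for approximate size it survives
  in full, because the corner vanishes with probability tending to 0. The cell weights leave no
  trace in the limit laws: the count of diagrams contributes the reciprocal of their product, and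
  the factors \<open>1 - x ^ (i + j + 1)\<close>, each scaled by \<open>n\<close>, contribute the
  product times \<open>(a * b) ^ (a * b)\<close>. What remains is the gamma density of shape and
  rate \<open>a * b\<close>, whose value at 1 is \<open>phi (a * b)\<close> and whose mass on the
  window is \<open>Phi (a * b) \<epsilon>\<close>.\<close>

definition pak_step :: "nat \<Rightarrow> nat \<Rightarrow> array \<Rightarrow> array" where
  "pak_step i j A = (\<lambda>(p, q).
     if p = i \<and> q = j then A (i, j) + max (A (i + 1, j)) (A (i, j + 1))
     else if i < p \<and> p + j = q + i
       then max (A (p + 1, q)) (A (p, q + 1)) + min (A (p - 1, q)) (A (p, q - 1)) - A (p, q)
     else A (p, q))"

text \<open>The toggle \<open>M + m - x\<close> is an involution as long as \<open>M\<close> and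
  \<open>m\<close>, read from the adjacent diagonals, stay fixed; so undoing a step toggles the same
  cells again, and only the corner operation differs. As in \<open>pak_step\<close> the diagonal is
  unbounded: on a boxed array the toggles beyond the box produce zeros.\<close>

definition pak_unstep :: "nat \<Rightarrow> nat \<Rightarrow> array \<Rightarrow> array" where
  "pak_unstep i j A = (\<lambda>(p, q).
     if p = i \<and> q = j then A (i, j) - max (A (i + 1, j)) (A (i, j + 1))
     else if i < p \<and> p + j = q + i
       then max (A (p + 1, q)) (A (p, q + 1)) + min (A (p - 1, q)) (A (p, q - 1)) - A (p, q)
     else A (p, q))"

text \<open>The cells finished once \<open>(i, j)\<close> is done, for rows from the bottom up and
  each row from right to left. The state just before the step at \<open>(i, j)\<close> is therefore
  indexed by \<open>(i, j + 1)\<close>.\<close>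

definition processed :: "nat \<Rightarrow> nat \<Rightarrow> nat \<Rightarrow> nat \<Rightarrow> bool" where
  "processed i j p q \<longleftrightarrow> i < p \<or> p = i \<and> j \<le> q"

definition decreasing_from :: "nat \<Rightarrow> nat \<Rightarrow> array \<Rightarrow> bool" where
  "decreasing_from i j A \<longleftrightarrow>
     (\<forall>p q. processed i j p q \<longrightarrow> A (p + 1, q) \<le> A (p, q) \<and> A (p, q + 1) \<le> A (p, q))"

lemma boxedD: "boxed a b A \<Longrightarrow> a \<le> i \<or> b \<le> j \<Longrightarrow> A (i, j) = 0"
  by (auto simp: boxed_def)

lemma boxed_nonzeroD: "boxed a b A \<Longrightarrow> 0 < A (i, j) \<Longrightarrow> i < a \<and> j < b"
  by (metis boxedD not_gr_zero not_le)

lemma pak_step_off [simp]: "x + j \<noteq> y + i \<Longrightarrow> pak_step i j A (x, y) = A (x, y)"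
  and pak_unstep_off [simp]: "x + j \<noteq> y + i \<Longrightarrow> pak_unstep i j A (x, y) = A (x, y)"
  by (auto simp: pak_step_def pak_unstep_def)

lemma pak_step_corner: "pak_step i j A (i, j) = A (i, j) + max (A (i + 1, j)) (A (i, j + 1))"
  and pak_unstep_corner: "pak_unstep i j A (i, j) = A (i, j) - max (A (i + 1, j)) (A (i, j + 1))"
  by (auto simp: pak_step_def pak_unstep_def)

lemma pak_step_untouched: "\<not> (i < p \<and> p + j = q + i) \<Longrightarrow> \<not> (p = i \<and> q = j) \<Longrightarrow> pak_step i j A (p, q) = A (p, q)"
  and pak_unstep_untouched: "\<not> (i < p \<and> p + j = q + i) \<Longrightarrow> \<not> (p = i \<and> q = j) \<Longrightarrow> pak_unstep i j A (p, q) = A (p, q)"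
  by (auto simp: pak_step_def pak_unstep_def)

lemma pak_step_on: "i < p \<Longrightarrow> p + j = q + i \<Longrightarrow> pak_step i j A (p, q) =
    max (A (p + 1, q)) (A (p, q + 1)) + min (A (p - 1, q)) (A (p, q - 1)) - A (p, q)"
  and pak_unstep_on: "i < p \<Longrightarrow> p + j = q + i \<Longrightarrow> pak_unstep i j A (p, q) =
    max (A (p + 1, q)) (A (p, q + 1)) + min (A (p - 1, q)) (A (p, q - 1)) - A (p, q)"
  by (auto simp: pak_step_def pak_unstep_def)

lemma decreasing_fromD:
  assumes "decreasing_from i j A" "processed i j p q"
  shows "A (Suc p, q) \<le> A (p, q)" "A (p, Suc q) \<le> A (p, q)"
  using assms by (auto simp: decreasing_from_def)

text \<open>With \<open>x\<close> between the maximum \<open>M\<close> of its lower and right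
  neighbours and the minimum \<open>m\<close> of its upper and left ones, \<open>M + m - x\<close>
  neither truncates nor leaves that interval. The upper neighbour of the first toggled cell is
  \<open>(i, j + 1)\<close>, which is already treated.\<close>

lemma decreasing_from_bounds:
  assumes A: "decreasing_from i (j + 1) A" and "i < p" "p + j = q + i"
  shows "max (A (p + 1, q)) (A (p, q + 1)) \<le> A (p, q)" "A (p, q) \<le> min (A (p - 1, q)) (A (p, q - 1))"
proof -
  have "processed i (j + 1) p q" "processed i (j + 1) (p - 1) q" "processed i (j + 1) p (q - 1)"
    using assms by (auto simp: processed_def)
  from this[THEN decreasing_fromD(1)[OF A]] this[THEN decreasing_fromD(2)[OF A]]
  show "max (A (p + 1, q)) (A (p, q + 1)) \<le> A (p, q)" "A (p, q) \<le> min (A (p - 1, q)) (A (p, q - 1))"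
    using assms by auto
qed

lemma decreasing_from_pak_step:
  assumes A: "decreasing_from i (j + 1) A"
  shows "decreasing_from i j (pak_step i j A)"
  unfolding decreasing_from_def
proof (intro allI impI)
  fix p q
  assume pq: "processed i j p q"
  have "processed i (j + 1) p q" if "\<not> (p = i \<and> q = j)"
    using pq that by (auto simp: processed_def)
  note d = this[THEN decreasing_fromD(1)[OF A]] this[THEN decreasing_fromD(2)[OF A]]
  \<comment> \<open>Neighbouring cells lie on different diagonals, so at most one of the three
    entries compared has changed: the corner, a toggled entry at \<open>(p, q)\<close>, a toggled
    lower one, a toggled right one, or none.\<close>
  consider "p = i" "q = j" | "i < p" "p + j = q + i" | "i < p + 1" "p + 1 + j = q + i" 
    | "i < p" "p + j = q + 1 + i"
    | "\<not> (p = i \<and> q = j)" "p + j \<noteq> q + i" "p + 1 + j \<noteq> q + i" "p + j \<noteq> q + 1 + i"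
    using pq by (force simp: processed_def)
  then show "pak_step i j A (p + 1, q) \<le> pak_step i j A (p, q) \<and>
             pak_step i j A (p, q + 1) \<le> pak_step i j A (p, q)"
  proof cases
    case 1
    then show ?thesis by (auto simp: pak_step_def)
  next
    case 2
    then show ?thesis using decreasing_from_bounds[OF A 2] by (auto simp: pak_step_def)
  next
    case 3
    then show ?thesis using decreasing_from_bounds[OF A, of "p + 1" q] d pq
      by (auto simp: pak_step_def processed_def)
  next
    case 4
    then show ?thesis using decreasing_from_bounds[OF A, of p "q + 1"] d pq
      by (auto simp: pak_step_def processed_def)
  next
    case 5
    then show ?thesis using d pq by (auto simp: pak_step_def processed_def)
  qed
qed

lemma boxed_pak_step:
  assumes "boxed a b A" "i < a" "j < b"
  shows "boxed a b (pak_step i j A)"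
  unfolding boxed_def
proof (intro allI impI)
  fix p q assume "a \<le> p \<or> b \<le> q"
  then show "pak_step i j A (p, q) = 0"
    using assms by (auto simp: pak_step_def boxed_def)
qed

lemma pak_unstep_pak_step:
  assumes A: "decreasing_from i (j + 1) A"
  shows "pak_unstep i j (pak_step i j A) = A"
proof (rule ext, clarify)
  fix p q
  show "pak_unstep i j (pak_step i j A) (p, q) = A (p, q)"
  proof (cases "i < p \<and> p + j = q + i")
    case True
    then have "pak_step i j A (p + 1, q) = A (p + 1, q)" "pak_step i j A (p, q + 1) = A (p, q + 1)"
      "pak_step i j A (p - 1, q) = A (p - 1, q)" "pak_step i j A (p, q - 1) = A (p, q - 1)"
      by (auto intro!: pak_step_off)
    moreover have "M + m - (M + m - x) = x" if "M \<le> x" "x \<le> m" for M m x :: nat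
      using that by simp
    ultimately show ?thesis using decreasing_from_bounds[OF A, of p q] True
      by (simp only: pak_unstep_on pak_step_on)
  next
    case False
    then show ?thesis
      by (cases "p = i \<and> q = j") (auto simp: pak_unstep_corner pak_step_corner
          pak_step_untouched pak_unstep_untouched)
  qed
qed

lemma boxed_pak_unstep:
  assumes "boxed a b A" "i < a" "j < b"
  shows "boxed a b (pak_unstep i j A)"
  unfolding boxed_def
proof (intro allI impI)
  fix p q assume "a \<le> p \<or> b \<le> q"
  then show "pak_unstep i j A (p, q) = 0"
    using assms by (auto simp: pak_unstep_def boxed_def)
qed

lemma decreasing_from_bounds':
  assumes A: "decreasing_from i j A" and "i < p" "p + j = q + i"
  shows "max (A (p + 1, q)) (A (p, q + 1)) \<le> A (p, q)" "A (p, q) \<le> min (A (p - 1, q)) (A (p, q - 1))"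
proof -
  have "decreasing_from i (j + 1) A"
    using A by (auto simp: decreasing_from_def processed_def)
  from decreasing_from_bounds[OF this assms(2,3)]
  show "max (A (p + 1, q)) (A (p, q + 1)) \<le> A (p, q)" "A (p, q) \<le> min (A (p - 1, q)) (A (p, q - 1))"
    by auto
qed

text \<open>Undoing the step gives up the corner: \<open>(i, j)\<close> is outside the region
  indexed by \<open>(i, j + 1)\<close>, so nothing is claimed about the entry restored
  there.\<close>

lemma decreasing_from_pak_unstep:
  assumes A: "decreasing_from i j A"
  shows "decreasing_from i (j + 1) (pak_unstep i j A)"
  unfolding decreasing_from_def
proof (intro allI impI)
  fix p q
  assume pq: "processed i (j + 1) p q"
  have "processed i j p q"
    using pq by (auto simp: processed_def)
  note d = this[THEN decreasing_fromD(1)[OF A]] this[THEN decreasing_fromD(2)[OF A]]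
  consider "i < p" "p + j = q + i" | "i < p + 1" "p + 1 + j = q + i" 
    | "i < p" "p + j = q + 1 + i"
    | "\<not> (p = i \<and> q = j)" "p + j \<noteq> q + i" "p + 1 + j \<noteq> q + i" "p + j \<noteq> q + 1 + i"
    using pq by (force simp: processed_def)
  then show "pak_unstep i j A (p + 1, q) \<le> pak_unstep i j A (p, q) \<and>
             pak_unstep i j A (p, q + 1) \<le> pak_unstep i j A (p, q)"
  proof cases
    case 1
    then show ?thesis using decreasing_from_bounds'[OF A 1] by (auto simp: pak_unstep_def)
  next
    case 2
    then show ?thesis using decreasing_from_bounds'[OF A, of "p + 1" q] d pq
      by (auto simp: pak_unstep_def processed_def)
  next
    case 3
    then show ?thesis using decreasing_from_bounds'[OF A, of p "q + 1"] d pq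
      by (auto simp: pak_unstep_def processed_def)
  next
    case 4
    then show ?thesis using d pq by (auto simp: pak_unstep_def processed_def)
  qed
qed

lemma pak_step_pak_unstep:
  assumes A: "decreasing_from i j A"
  shows "pak_step i j (pak_unstep i j A) = A"
proof (rule ext, clarify)
  fix p q
  show "pak_step i j (pak_unstep i j A) (p, q) = A (p, q)"
  proof (cases "i < p \<and> p + j = q + i")
    case True
    then have "pak_unstep i j A (p + 1, q) = A (p + 1, q)" "pak_unstep i j A (p, q + 1) = A (p, q + 1)"
      "pak_unstep i j A (p - 1, q) = A (p - 1, q)" "pak_unstep i j A (p, q - 1) = A (p, q - 1)"
      by (auto intro!: pak_unstep_off)
    moreover have "M + m - (M + m - x) = x" if "M \<le> x" "x \<le> m" for M m x :: nat
      using that by simp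
    ultimately show ?thesis using decreasing_from_bounds'[OF A, of p q] True
      by (simp only: pak_step_on pak_unstep_on)
  next
    case False
    \<comment> \<open>The corner subtraction is exact because the corner belongs to the decreasing
      region.\<close>
    moreover have "max (A (i + 1, j)) (A (i, j + 1)) \<le> A (i, j)"
      using decreasing_fromD[OF A, of i j] by (simp add: processed_def)
    ultimately show ?thesis
      by (cases "p = i \<and> q = j") (auto simp: pak_unstep_corner pak_step_corner
          pak_step_untouched pak_unstep_untouched simp del: max.bounded_iff)
  qed
qed

lemma bij_betw_pak_step:
  assumes "i < a" "j < b"
  shows "bij_betw (pak_step i j) {A. boxed a b A \<and> decreasing_from i (j + 1) A}
           {A. boxed a b A \<and> decreasing_from i j A}"
  using assms
  by (intro bij_betw_byWitness[where f' = "pak_unstep i j"])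
     (auto simp: pak_unstep_pak_step pak_step_pak_unstep boxed_pak_step boxed_pak_unstep
        decreasing_from_pak_step[simplified] decreasing_from_pak_unstep[simplified])

section \<open>Composition of the steps over rows and over the box\<close>

definition pak_row :: "nat \<Rightarrow> nat \<Rightarrow> array \<Rightarrow> array" where
  "pak_row b i = fold (pak_step i) (rev [0..<b])"

definition pak_map :: "nat \<Rightarrow> nat \<Rightarrow> array \<Rightarrow> array" where
  "pak_map a b = fold (pak_row b) (rev [0..<a])"

text \<open>The length argument doubles as a progress counter: since columns run downwards,
  \<open>pak_row j i\<close> is what remains of row \<open>i\<close> once the columns from
  \<open>j\<close> on are done. The row count of \<open>pak_map\<close> is used in the same
  way.\<close>

lemma bij_betw_pak_row:
  assumes "i < a" "j \<le> b"
  shows "bij_betw (pak_row j i) {A. boxed a b A \<and> decreasing_from i j A}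
           {A. boxed a b A \<and> decreasing_from i 0 A}"
  using assms(2)
proof (induction j)
  case 0
  show ?case by (simp add: pak_row_def bij_betw_def)
next
  case (Suc j)
  have "bij_betw (pak_row j i \<circ> pak_step i j) {A. boxed a b A \<and> decreasing_from i (j + 1) A}
           {A. boxed a b A \<and> decreasing_from i 0 A}"
    using Suc bij_betw_pak_step[of i a j b] assms(1) by (intro bij_betw_trans) auto
  then show ?case by (simp add: pak_row_def o_def)
qed

text \<open>This glues consecutive rows: the two regions differ only in the cells of row
  \<open>i\<close> from column \<open>b\<close> on, where a boxed array is zero and the inequalities
  are trivial.\<close>

lemma boxed_decreasing_from_next_row:
  assumes "boxed a b A"
  shows "decreasing_from (Suc i) 0 A \<longleftrightarrow> decreasing_from i b A"
proof -
  have "A (p + 1, q) \<le> A (p, q) \<and> A (p, q + 1) \<le> A (p, q)" if "b \<le> q" for p q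
    using that assms by (auto simp: boxed_def)
  moreover have "processed (Suc i) 0 p q \<longleftrightarrow> i < p" "processed i b p q \<longleftrightarrow> i < p \<or> p = i \<and> b \<le> q" for p q
    by (auto simp: processed_def)
  ultimately show ?thesis
    unfolding decreasing_from_def by blast
qed

lemma boxed_decreasing_from_bottom: "boxed a b A \<Longrightarrow> decreasing_from a 0 A"
  by (auto simp: decreasing_from_def processed_def boxed_def)

lemma bij_betw_pak_map_rows:
  assumes "i \<le> a"
  shows "bij_betw (pak_map i b) {A. boxed a b A \<and> decreasing_from i 0 A}
           {A. boxed a b A \<and> decreasing_from 0 0 A}"
  using assms
proof (induction i)
  case 0
  show ?case by (simp add: pak_map_def bij_betw_def)
next
  case (Suc i)
  have "bij_betw (pak_map i b \<circ> pak_row b i) {A. boxed a b A \<and> decreasing_from i b A}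
           {A. boxed a b A \<and> decreasing_from 0 0 A}"
    using Suc bij_betw_pak_row[of i a b b] by (intro bij_betw_trans) auto
  also have "{A. boxed a b A \<and> decreasing_from i b A} = {A. boxed a b A \<and> decreasing_from (Suc i) 0 A}"
    using boxed_decreasing_from_next_row by blast
  finally show ?case by (simp add: pak_map_def o_def)
qed

lemma finite_nonzero_boxed: "boxed a b A \<Longrightarrow> finite {c. A c \<noteq> 0}"
  by (rule finite_subset[of _ "{..<a} \<times> {..<b}"]) (auto dest: boxed_nonzeroD)

lemma bij_betw_pak_map: "bij_betw (pak_map a b) {D. boxed a b D} (boxed_plane_partitions a b)"
proof -
  have all: "processed 0 0 p q" for p q
    by (auto simp: processed_def)
  have "{A. boxed a b A \<and> decreasing_from 0 0 A} = boxed_plane_partitions a b"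
    using finite_nonzero_boxed
    by (auto simp del: neq0_conv simp: boxed_plane_partitions_def plane_partition_def
        decreasing_from_def all simp flip: Suc_eq_plus1)
  moreover have "{A. boxed a b A \<and> decreasing_from a 0 A} = {D. boxed a b D}"
    using boxed_decreasing_from_bottom by blast
  ultimately show ?thesis
    using bij_betw_pak_map_rows[of a a b] by simp
qed

lemma pak_map_surj:
  assumes "\<pi> \<in> boxed_plane_partitions a b"
  shows "\<exists>D. boxed a b D \<and> pak_map a b D = \<pi>"
proof -
  have "\<pi> \<in> pak_map a b ` {D. boxed a b D}"
    using assms bij_betw_imp_surj_on[OF bij_betw_pak_map, of a b] by simp
  then show ?thesis by blast
qed

section \<open>Diagonal sums\<close>

definition diag_sum :: "nat \<Rightarrow> array \<Rightarrow> nat \<Rightarrow> nat \<Rightarrow> nat" where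
  "diag_sum n A p q = (\<Sum>c<n. A (p + c, q + c))"

definition rect_sum :: "nat \<Rightarrow> array \<Rightarrow> nat \<Rightarrow> nat \<Rightarrow> nat" where
  "rect_sum n D p q = (\<Sum>x<n. \<Sum>y<n. if p \<le> x \<and> q \<le> y then D (x, y) else 0)"

text \<open>The sum telescopes: the maximum used at a diagonal cell and the minimum used at the next
  cell down the diagonal are taken over the same two entries, so together they give the sum of these
  entries. Only the last maximum stays unpaired; it vanishes once the diagonal has left the
  box.\<close>

lemma diag_sum_pak_step_truncated:
  assumes A: "decreasing_from i (j + 1) A"
  shows "diag_sum (Suc n) (pak_step i j A) i j + diag_sum n A (i + 1) (j + 1) =
    A (i, j) + diag_sum n A (i + 1) j + diag_sum n A i (j + 1) +
    max (A (i + 1 + n, j + n)) (A (i + n, j + 1 + n))"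
proof (induction n)
  case 0
  show ?case by (simp add: diag_sum_def pak_step_def)
next
  case (Suc n)
  have "pak_step i j A (i + Suc n, j + Suc n) + A (i + Suc n, j + Suc n) =
      max (A (i + 1 + Suc n, j + Suc n)) (A (i + Suc n, j + 1 + Suc n)) +
      min (A (i + n, j + Suc n)) (A (i + Suc n, j + n))"
    using decreasing_from_bounds[OF A, of "i + Suc n" "j + Suc n"]
    by (simp add: pak_step_def del: max.bounded_iff min.bounded_iff)
  moreover have "max (A (i + 1 + n, j + n)) (A (i + n, j + 1 + n)) +
      min (A (i + n, j + Suc n)) (A (i + Suc n, j + n)) = A (i + 1 + n, j + n) + A (i + n, j + 1 + n)"
    by (simp add: max_def min_def)
  ultimately show ?case using Suc.IH by (simp add: diag_sum_def)
qed

lemma diag_sum_Suc: "boxed n n A \<Longrightarrow> diag_sum (Suc n) A p q = diag_sum n A p q"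
  by (simp add: diag_sum_def boxed_def)

lemma diag_sum_pak_step:
  assumes "decreasing_from i (j + 1) A" "boxed n n A" "i < n" "j < n"
  shows "diag_sum n (pak_step i j A) i j + diag_sum n A (i + 1) (j + 1) =
    A (i, j) + diag_sum n A (i + 1) j + diag_sum n A i (j + 1)"
  using diag_sum_pak_step_truncated[OF assms(1), of n] diag_sum_Suc[OF boxed_pak_step[OF assms(2-4)]] assms(2)
  by (simp add: boxedD)

lemma diag_sum_pak_step_other:
  assumes "p + j \<noteq> q + i"
  shows "diag_sum n (pak_step i j A) p q = diag_sum n A p q"
  using assms by (auto simp: diag_sum_def pak_step_def intro!: sum.cong)

lemma rect_sum_rec:
  assumes "i < n" "j < n"
  shows "rect_sum n D i j + rect_sum n D (i + 1) (j + 1) =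
    D (i, j) + rect_sum n D (i + 1) j + rect_sum n D i (j + 1)"
proof -
  \<comment> \<open>Spreading \<open>D (i, j)\<close> over the same double sum turns
    inclusion-exclusion into an identity for each summand.\<close>
  have "D (i, j) = (\<Sum>x<n. if x = i then D (x, j) else 0)"
    using assms by simp
  also have "\<dots> = (\<Sum>x<n. \<Sum>y<n. if y = j then (if x = i then D (x, y) else 0) else 0)"
    using assms by (intro sum.cong) simp_all
  finally have D: "D (i, j) = \<dots>" .
  show ?thesis unfolding D
    unfolding rect_sum_def sum.distrib[symmetric]
    by (intro sum.cong) auto
qed

text \<open>The first clause concerns only the topmost treated cell of each diagonal, the one whose
  upper left neighbour is untreated or missing. The second supplies the original entry that the next
  step consumes.\<close>

definition diag_invariant :: "nat \<Rightarrow> nat \<Rightarrow> nat \<Rightarrow> array \<Rightarrow> array \<Rightarrow> bool" where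
  "diag_invariant n i j D A \<longleftrightarrow>
     (\<forall>p q. processed i j p q \<and> (p = 0 \<or> q = 0 \<or> \<not> processed i j (p - 1) (q - 1)) \<longrightarrow>
        diag_sum n A p q = rect_sum n D p q) \<and>
     (\<forall>p q. \<not> processed i j p q \<longrightarrow> A (p, q) = D (p, q))"

lemma diag_invariant_pak_step:
  assumes A: "decreasing_from i (j + 1) A" "boxed n n A" "i < n" "j < n"
    and I: "diag_invariant n i (j + 1) D A"
  shows "diag_invariant n i j D (pak_step i j A)"
  unfolding diag_invariant_def
proof (intro conjI allI impI)
  have S: "diag_sum n A p q = rect_sum n D p q"
    if "processed i (j + 1) p q" "p = 0 \<or> q = 0 \<or> \<not> processed i (j + 1) (p - 1) (q - 1)" for p q
    using I that by (auto simp: diag_invariant_def)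
  have ij: "diag_sum n (pak_step i j A) i j = rect_sum n D i j"
  proof -
    have "A (i, j) = D (i, j)"
      using I by (auto simp: diag_invariant_def processed_def)
    \<comment> \<open>All three cells are topmost on their diagonals before the step, so the
      invariant covers exactly the sums that the recursion needs.\<close>
    moreover have "diag_sum n A (i + 1) (j + 1) = rect_sum n D (i + 1) (j + 1)"
      "diag_sum n A (i + 1) j = rect_sum n D (i + 1) j"
      "diag_sum n A i (j + 1) = rect_sum n D i (j + 1)"
      by (auto intro!: S simp: processed_def)
    ultimately show ?thesis
      using diag_sum_pak_step[OF A] rect_sum_rec[OF A(3,4), of D] by simp
  qed
  fix p q
  assume "processed i j p q \<and> (p = 0 \<or> q = 0 \<or> \<not> processed i j (p - 1) (q - 1))"
  then consider "p = i" "q = j" | "p + j \<noteq> q + i" "processed i (j + 1) p q"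
      "p = 0 \<or> q = 0 \<or> \<not> processed i (j + 1) (p - 1) (q - 1)"
    by (cases "p = i \<and> q = j"; cases "p + j = q + i") (auto simp: processed_def)
  then show "diag_sum n (pak_step i j A) p q = rect_sum n D p q"
    by cases (auto simp: ij diag_sum_pak_step_other S)
next
  fix p q
  assume "\<not> processed i j p q"
  then show "pak_step i j A (p, q) = D (p, q)"
    using I by (auto simp: diag_invariant_def processed_def pak_step_def)
qed

lemma pak_row_invariant:
  assumes "i < a" "j \<le> b" "a \<le> n" "b \<le> n"
    and "boxed a b A" "decreasing_from i j A" "diag_invariant n i j D A"
  shows "boxed a b (pak_row j i A) \<and> decreasing_from i 0 (pak_row j i A) \<and>
    diag_invariant n i 0 D (pak_row j i A)"
  using assms(2,5-)
proof (induction j arbitrary: A)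
  case 0
  then show ?case by (simp add: pak_row_def)
next
  case (Suc j)
  have "boxed n n A"
    using Suc.prems(2) assms(3,4) by (auto simp: boxed_def)
  then have "boxed a b (pak_row j i (pak_step i j A)) \<and> decreasing_from i 0 (pak_row j i (pak_step i j A)) \<and>
    diag_invariant n i 0 D (pak_row j i (pak_step i j A))"
    using Suc.prems assms(1,3,4) decreasing_from_pak_step[of i j A]
    by (intro Suc.IH) (auto intro!: boxed_pak_step diag_invariant_pak_step)
  then show ?case by (simp add: pak_row_def)
qed

lemma diag_invariant_next_row:
  assumes "boxed a b A" "boxed a b D" "diag_invariant n (Suc i) 0 D A"
  shows "diag_invariant n i b D A"
proof -
  have "diag_sum n A p q = rect_sum n D p q" if "b \<le> q" for p q
    using that assms(1,2) by (auto simp: diag_sum_def rect_sum_def boxed_def intro!: sum.neutral)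
  moreover have "A (p, q) = D (p, q)" if "b \<le> q" for p q
    using that assms(1,2) by (auto simp: boxed_def)
  moreover have "processed (Suc i) 0 p q \<and> (p = 0 \<or> q = 0 \<or> \<not> processed (Suc i) 0 (p - 1) (q - 1))"
    if "processed i b p q" "p = 0 \<or> q = 0 \<or> \<not> processed i b (p - 1) (q - 1)" "q < b" for p q
    using that by (auto simp: processed_def)
  moreover have "\<not> processed (Suc i) 0 p q" if "\<not> processed i b p q" for p q
    using that by (auto simp: processed_def)
  moreover note * = calculation
  show ?thesis unfolding diag_invariant_def
  proof (intro conjI allI impI)
    fix p q
    assume "processed i b p q \<and> (p = 0 \<or> q = 0 \<or> \<not> processed i b (p - 1) (q - 1))"
    then show "diag_sum n A p q = rect_sum n D p q"
      using * assms(3) unfolding diag_invariant_def by (cases "q < b") auto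
  next
    fix p q
    assume "\<not> processed i b p q"
    then show "A (p, q) = D (p, q)"
      using * assms(3) unfolding diag_invariant_def by auto
  qed
qed

lemma pak_map_invariant:
  assumes "i \<le> a" "a \<le> n" "b \<le> n" "boxed a b D"
    and "boxed a b A" "decreasing_from i 0 A" "diag_invariant n i 0 D A"
  shows "diag_invariant n 0 0 D (pak_map i b A)"
  using assms(1,5-)
proof (induction i arbitrary: A)
  case 0
  then show ?case by (simp add: pak_map_def)
next
  case (Suc i)
  have "boxed a b (pak_row b i A) \<and> decreasing_from i 0 (pak_row b i A) \<and>
    diag_invariant n i 0 D (pak_row b i A)"
    using Suc.prems assms(2,3,4) boxed_decreasing_from_next_row[of a b A i] diag_invariant_next_row
    by (intro pak_row_invariant[where a = a and b = b]) auto
  then have "diag_invariant n 0 0 D (pak_map i b (pak_row b i A))"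
    using Suc.prems by (intro Suc.IH) auto
  then show ?case by (simp add: pak_map_def)
qed

text \<open>Each diagonal starts in the first row or, below the origin, in the first column. The
  first sum collects the entries with \<open>x \<le> y\<close>, the second those with
  \<open>y < x\<close>.\<close>

lemma sum_by_diagonals:
  assumes "boxed n n A"
  shows "(\<Sum>q<n. diag_sum n A 0 q) + (\<Sum>p\<in>{1..<n}. diag_sum n A p 0) = (\<Sum>x<n. \<Sum>y<n. A (x, y))"
proof -
  have "(\<Sum>q<n. A (c, q + c)) = (\<Sum>y<n. if c \<le> y then A (c, y) else 0)" if "c < n" for c
  proof -
    have "(\<Sum>q<n. A (c, q + c)) = (\<Sum>q<n - c. A (c, q + c))"
      using assms by (intro sum.mono_neutral_right) (auto simp: boxed_def)
    also have "\<dots> = (\<Sum>y\<in>{c..<n}. A (c, y))"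
      using that by (intro sum.reindex_bij_witness[of _ "\<lambda>y. y - c" "\<lambda>q. q + c"]) auto
    also have "\<dots> = (\<Sum>y<n. if c \<le> y then A (c, y) else 0)"
      by (intro sum.mono_neutral_cong_right sum.mono_neutral_cong_left) auto
    finally show ?thesis .
  qed
  then have 1: "(\<Sum>q<n. diag_sum n A 0 q) = (\<Sum>x<n. \<Sum>y<n. if x \<le> y then A (x, y) else 0)"
    unfolding diag_sum_def by (subst sum.swap) (auto intro!: sum.cong)
  have "(\<Sum>p\<in>{1..<n}. A (p + c, c)) = (\<Sum>x<n. if c < x then A (x, c) else 0)" if "c < n" for c
  proof -
    have "(\<Sum>p\<in>{1..<n}. A (p + c, c)) = (\<Sum>p\<in>{1..<n - c}. A (p + c, c))"
      using assms by (intro sum.mono_neutral_right) (auto simp: boxed_def)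
    also have "\<dots> = (\<Sum>x\<in>{c<..<n}. A (x, c))"
      using that by (intro sum.reindex_bij_witness[of _ "\<lambda>y. y - c" "\<lambda>q. q + c"]) auto
    also have "\<dots> = (\<Sum>x<n. if c < x then A (x, c) else 0)"
      by (intro sum.mono_neutral_cong_right sum.mono_neutral_cong_left) auto
    finally show ?thesis .
  qed
  then have 2: "(\<Sum>p\<in>{1..<n}. diag_sum n A p 0) = (\<Sum>y<n. \<Sum>x<n. if y < x then A (x, y) else 0)"
    unfolding diag_sum_def by (subst sum.swap) (auto intro!: sum.cong)
  have 3: "(\<Sum>y<n. \<Sum>x<n. if y < x then A (x, y) else 0) = (\<Sum>x<n. \<Sum>y<n. if y < x then A (x, y) else 0)"
    by (rule sum.swap)
  show ?thesis
    unfolding 1 2 3 sum.distrib[symmetric] by (intro sum.cong) auto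
qed

text \<open>The entry at \<open>(x, y)\<close> lies in the \<open>y + 1\<close> rectangles starting
  at \<open>(0, q)\<close> with \<open>q \<le> y\<close>, and in the \<open>x\<close> rectangles
  starting at \<open>(p, 0)\<close> with \<open>1 \<le> p \<le> x\<close>.\<close>

lemma sum_rect_sums:
  "(\<Sum>q<n. rect_sum n D 0 q) + (\<Sum>p\<in>{1..<n}. rect_sum n D p 0) =
     (\<Sum>x<n. \<Sum>y<n. D (x, y) * (x + y + 1))"
proof -
  have "(\<Sum>q<n. rect_sum n D 0 q) = (\<Sum>x<n. \<Sum>q<n. \<Sum>y<n. if q \<le> y then D (x, y) else 0)"
    unfolding rect_sum_def by (subst sum.swap) simp
  also have "\<dots> = (\<Sum>x<n. \<Sum>y<n. \<Sum>q<n. if q \<le> y then D (x, y) else 0)"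
    by (subst (2) sum.swap) simp
  also have "\<dots> = (\<Sum>x<n. \<Sum>y<n. D (x, y) * (y + 1))"
  proof (intro sum.cong refl)
    fix x y assume "y \<in> {..<n}"
    then have "(\<Sum>q<n. if q \<le> y then D (x, y) else 0) = (\<Sum>q\<in>{..y}. D (x, y))"
      by (intro sum.mono_neutral_cong_right sum.mono_neutral_cong_left) auto
    then show "(\<Sum>q<n. if q \<le> y then D (x, y) else 0) = D (x, y) * (y + 1)"
      by simp
  qed
  finally have 1: "(\<Sum>q<n. rect_sum n D 0 q) = \<dots>" .
  have "(\<Sum>p\<in>{1..<n}. rect_sum n D p 0) = (\<Sum>x<n. \<Sum>p\<in>{1..<n}. \<Sum>y<n. if p \<le> x then D (x, y) else 0)"
    unfolding rect_sum_def by (subst sum.swap) simp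
  also have "\<dots> = (\<Sum>x<n. \<Sum>y<n. \<Sum>p\<in>{1..<n}. if p \<le> x then D (x, y) else 0)"
    by (subst (2) sum.swap) simp
  also have "\<dots> = (\<Sum>x<n. \<Sum>y<n. D (x, y) * x)"
  proof (intro sum.cong refl)
    fix x y assume "x \<in> {..<n}"
    then have "(\<Sum>p\<in>{1..<n}. if p \<le> x then D (x, y) else 0) = (\<Sum>p\<in>{1..x}. D (x, y))"
      by (intro sum.mono_neutral_cong_right sum.mono_neutral_cong_left) auto
    then show "(\<Sum>p\<in>{1..<n}. if p \<le> x then D (x, y) else 0) = D (x, y) * x"
      by simp
  qed
  finally have 2: "(\<Sum>p\<in>{1..<n}. rect_sum n D p 0) = \<dots>" .
  show ?thesis unfolding 1 2 sum.distrib[symmetric]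
    by (intro sum.cong) (auto simp: algebra_simps)
qed

lemma partition_size_boxed:
  assumes "boxed a b A"
  shows "partition_size A = (\<Sum>c\<in>{..<a} \<times> {..<b}. A c)"
  unfolding partition_size_def using assms
  by (intro sum.mono_neutral_left) (auto dest: boxed_nonzeroD)

lemma diagram_size_boxed:
  assumes "boxed a b A"
  shows "diagram_size A = (\<Sum>(i, j)\<in>{..<a} \<times> {..<b}. A (i, j) * (i + j + 1))"
  unfolding diagram_size_def using assms
  by (intro sum.mono_neutral_left) (auto dest: boxed_nonzeroD)

lemma boxed_pak_map: "boxed a b D \<Longrightarrow> boxed a b (pak_map a b D)"
  using bij_betw_apply[OF bij_betw_pak_map, of D a b] by (auto simp: boxed_plane_partitions_def)

lemma partition_size_pak_map:
  assumes "boxed a b D"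
  shows "partition_size (pak_map a b D) = diagram_size D"
proof -
  define n where "n = max a b"
  have n: "a \<le> n" "b \<le> n" by (auto simp: n_def)
  define A where "A = pak_map a b D"
  have box: "boxed n n D" "boxed n n A"
    using n assms boxed_pak_map[OF assms] by (auto simp: boxed_def A_def)
  \<comment> \<open>Before any step the treated cells are those in rows from \<open>a\<close> on,
    where both kinds of sums vanish.\<close>
  have "diag_sum n D p q = rect_sum n D p q" if "a \<le> p" for p q
    using that assms by (auto simp: diag_sum_def rect_sum_def boxed_def intro!: sum.neutral)
  then have "diag_invariant n a 0 D D"
    by (auto simp: diag_invariant_def processed_def)
  then have I: "diag_invariant n 0 0 D A" unfolding A_def
    using n assms boxed_decreasing_from_bottom by (intro pak_map_invariant[where a = a]) auto
  have "partition_size A = (\<Sum>x<n. \<Sum>y<n. A (x, y))"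
    by (subst partition_size_boxed[OF box(2)]) (simp add: sum.cartesian_product)
  also have "\<dots> = (\<Sum>q<n. diag_sum n A 0 q) + (\<Sum>p\<in>{1..<n}. diag_sum n A p 0)"
    using sum_by_diagonals[OF box(2)] by simp
  also have "\<dots> = (\<Sum>q<n. rect_sum n D 0 q) + (\<Sum>p\<in>{1..<n}. rect_sum n D p 0)"
    using I by (auto simp: diag_invariant_def processed_def)
  also have "\<dots> = diagram_size D"
    unfolding sum_rect_sums diagram_size_boxed[OF box(1)]
    by (simp add: sum.cartesian_product)
  finally show ?thesis by (simp add: A_def)
qed

section \<open>Reduction of the imperative transform and its cost\<close>

text \<open>A toggle reads its own entry and entries on the adjacent diagonals, so running the
  toggles one after another agrees with a simultaneous update. The diagonal has one cell per row, so
  \<open>p \<le> i + n\<close> says which of its cells are done after \<open>n\<close>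
  toggles.\<close>

lemma fold_pak_toggle:
  "fold (pak_toggle i j) [1..<n + 1] (pak_add i j (A, t)) =
     (\<lambda>(p, q). if p \<le> i + n then pak_step i j A (p, q) else A (p, q), t + n + 1)"
proof (induction n)
  case 0
  show ?case
    by (auto simp: pak_add_def assign_def pak_step_def fun_eq_iff)
next
  case (Suc n)
  have "fold (pak_toggle i j) [1..<Suc n + 1] (pak_add i j (A, t)) =
    pak_toggle i j (n + 1) (\<lambda>(p, q). if p \<le> i + n then pak_step i j A (p, q) else A (p, q), t + n + 1)"
    using Suc.IH by simp
  also have "\<dots> = (\<lambda>(p, q). if p \<le> i + Suc n then pak_step i j A (p, q) else A (p, q), t + Suc n + 1)"
  proof -
    define F where "F = (\<lambda>(p, q). if p \<le> i + n then pak_step i j A (p, q) else A (p, q))"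
    define G where "G = (\<lambda>(p, q). if p \<le> i + Suc n then pak_step i j A (p, q) else A (p, q))"
    have F: "F (x, y) = A (x, y)" if "x + j \<noteq> y + i \<or> i + n < x" for x y
      using that by (auto simp: F_def)
    have "F((i + (n + 1), j + (n + 1)) := max (F (i + (n + 1) + 1, j + (n + 1))) (F (i + (n + 1), j + (n + 1) + 1)) +
       min (F (i + (n + 1) - 1, j + (n + 1))) (F (i + (n + 1), j + (n + 1) - 1)) - F (i + (n + 1), j + (n + 1))) = G"
      (is "F(?x := ?y) = G")
    proof -
      have "?y = pak_step i j A (i + (n + 1), j + (n + 1))"
        by (subst pak_step_on) (simp_all add: F)
      moreover have "F (p, q) = G (p, q)" if "(p, q) \<noteq> ?x" for p q
      proof (cases "p = i + Suc n")
        case True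
        then have "p + j \<noteq> q + i" using that by auto
        then show ?thesis by (simp add: F_def G_def)
      qed (auto simp: F_def G_def)
      ultimately show ?thesis by (auto simp: fun_eq_iff G_def)
    qed
    then show ?thesis
      by (simp add: pak_toggle_def assign_def Let_def flip: F_def) (simp add: G_def)
  qed
  finally show ?case .
qed

text \<open>The toggles that fit into the rectangle and the corner assignment add up to
  \<open>min (l - i) (w - j)\<close>. Any further toggle on the diagonal would turn a zero into a
  zero.\<close>

lemma pak_cell_boxed:
  assumes "boxed l w A" "i < l" "j < w"
  shows "pak_cell l w i j (A, t) = (pak_step i j A, t + min (l - i) (w - j))"
proof -
  define n where "n = min (l - 1 - i) (w - 1 - j)"
  have "pak_step i j A (p, q) = A (p, q)" if "i + n < p" for p q
  proof (cases "p + j = q + i")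
    case True
    then have "l \<le> p \<or> w \<le> q" using that assms by (auto simp: n_def)
    then show ?thesis using boxedD[OF assms(1)] boxedD[OF boxed_pak_step[OF assms]] by simp
  qed simp
  then have "(\<lambda>(p, q). if p \<le> i + n then pak_step i j A (p, q) else A (p, q)) = pak_step i j A"
    by (auto simp: fun_eq_iff)
  moreover have "n + 1 = min (l - i) (w - j)"
    using assms by (auto simp: n_def)
  ultimately show ?thesis
    using fold_pak_toggle[of i j n A t] by (simp add: pak_cell_def n_def)
qed

lemma boxed_pak_row:
  assumes "i < l" "k \<le> w" "boxed l w A"
  shows "boxed l w (pak_row k i A)"
  using assms(2,3) by (induction k arbitrary: A) (simp_all add: pak_row_def boxed_pak_step[OF _ assms(1)])

lemma pak_row_Suc: "pak_row (Suc k) i A = pak_row k i (pak_step i k A)"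
  by (simp add: pak_row_def)

lemma pak_map_Suc: "pak_map (Suc k) b A = pak_map k b (pak_row b k A)"
  by (simp add: pak_map_def)

lemma fold_pak_cell:
  assumes "boxed l w A" "i < l" "k \<le> w"
  shows "fold (\<lambda>j. pak_cell l w i j) (rev [0..<k]) (A, t) =
    (pak_row k i A, t + (\<Sum>j<k. min (l - i) (w - j)))"
  using assms(1,3)
proof (induction k arbitrary: A t)
  case 0
  then show ?case by (simp add: pak_row_def)
next
  case (Suc k)
  then show ?case
    using assms(2) by (simp add: pak_cell_boxed pak_row_Suc boxed_pak_step del: fun_upd_apply)
qed

definition pak_cost :: "nat \<Rightarrow> nat \<Rightarrow> nat" where
  "pak_cost l w = (\<Sum>i<l. \<Sum>j<w. min (l - i) (w - j))"

lemma fold_pak_rows: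
  assumes "boxed l w A" "k \<le> l"
  shows "fold (\<lambda>i. fold (\<lambda>j. pak_cell l w i j) (rev [0..<w])) (rev [0..<k]) (A, t) =
    (pak_map k w A, t + (\<Sum>i<k. \<Sum>j<w. min (l - i) (w - j)))"
  using assms
proof (induction k arbitrary: A t)
  case 0
  then show ?case by (simp add: pak_map_def)
next
  case (Suc k)
  then show ?case
    by (simp add: fold_pak_cell pak_map_Suc boxed_pak_row)
qed

section \<open>From the bounding rectangle to the full box\<close>

lemma bounding_box:
  assumes "boxed a b D"
  shows "boxed (bounding_length D) (bounding_width D) D" "bounding_length D \<le> a" "bounding_width D \<le> b"
proof -
  have l: "\<forall>i j. a \<le> i \<longrightarrow> D (i, j) = 0" and w: "\<forall>i j. b \<le> j \<longrightarrow> D (i, j) = 0"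
    using assms by (auto simp: boxed_def)
  have "\<forall>i j. bounding_length D \<le> i \<longrightarrow> D (i, j) = 0"
    unfolding bounding_length_def using l by (rule LeastI)
  moreover have "\<forall>i j. bounding_width D \<le> j \<longrightarrow> D (i, j) = 0"
    unfolding bounding_width_def using w by (rule LeastI)
  ultimately show "boxed (bounding_length D) (bounding_width D) D"
    unfolding boxed_def by blast
  show "bounding_length D \<le> a" "bounding_width D \<le> b"
    unfolding bounding_length_def bounding_width_def
    using Least_le[of "\<lambda>l. \<forall>i j. l \<le> i \<longrightarrow> D (i, j) = 0", OF l]
      Least_le[of "\<lambda>w. \<forall>i j. w \<le> j \<longrightarrow> D (i, j) = 0", OF w] by blast+
qed

lemma pak_step_outside:
  assumes "boxed l w A" "l \<le> i \<or> w \<le> j"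
  shows "pak_step i j A = A"
proof (rule ext, clarify)
  fix p q
  have "l \<le> p \<or> w \<le> q" if "i \<le> p" "j \<le> q"
    using assms(2) that by auto
  then show "pak_step i j A (p, q) = A (p, q)"
    using assms by (cases "i < p \<and> p + j = q + i"; cases "p = i \<and> q = j")
      (auto simp: pak_step_on pak_step_corner pak_step_untouched boxed_def)
qed

lemma pak_row_outside: "boxed l w A \<Longrightarrow> l \<le> i \<Longrightarrow> pak_row k i A = A"
  by (induction k) (simp_all add: pak_row_Suc pak_step_outside, simp add: pak_row_def)

lemma pak_row_widen:
  assumes "boxed l w A" "w \<le> b"
  shows "pak_row b i A = pak_row w i A"
  using assms(2) by (induction b rule: dec_induct) (simp_all add: pak_row_Suc pak_step_outside[OF assms(1)])

text \<open>The additional rows, and the additional columns of each row, come first in the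
  processing order, so the steps there act on arrays still confined to the rectangle and read only
  zeros.\<close>

lemma pak_map_widen:
  assumes "boxed l w D" "l \<le> a" "w \<le> b"
  shows "pak_map a b D = pak_map l w D"
proof -
  have "pak_map k b A = pak_map k w A" if "k \<le> l" "boxed l w A" for k A
    using that
  proof (induction k arbitrary: A)
    case 0
    show ?case by (simp add: pak_map_def)
  next
    case (Suc k)
    then show ?case
      using pak_row_widen[OF Suc.prems(2) assms(3), of k] by (simp add: pak_map_Suc boxed_pak_row)
  qed
  moreover have "pak_map a b D = pak_map l b D"
    using assms(2) by (induction a rule: dec_induct) (simp_all add: pak_map_Suc pak_row_outside[OF assms(1)])
  ultimately show ?thesis using assms(1) by simp
qed

lemma pak_transform_eq:
  assumes "boxed a b D"
  shows "pak_transform D = (pak_map a b D, pak_cost (bounding_length D) (bounding_width D))"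
  using fold_pak_rows[OF bounding_box(1)[OF assms], of _ 0] pak_map_widen[OF bounding_box[OF assms]]
  by (simp add: pak_transform_def pak_cost_def Let_def)

lemma pak_cost_mono:
  assumes "l \<le> a" "w \<le> b"
  shows "pak_cost l w \<le> pak_cost a b"
proof -
  have "pak_cost l w \<le> (\<Sum>i<l. \<Sum>j<w. min (a - i) (b - j))"
    unfolding pak_cost_def using assms by (intro sum_mono) auto
  also have "\<dots> \<le> (\<Sum>i<l. \<Sum>j<b. min (a - i) (b - j))"
    using assms by (intro sum_mono sum_mono2) auto
  also have "\<dots> \<le> pak_cost a b"
    unfolding pak_cost_def using assms by (intro sum_mono2) auto
  finally show ?thesis .
qed

section \<open>Closed form of the number of assignments\<close>

lemma sum_min_row:
  assumes "Suc i \<le> n"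
  shows "(\<Sum>j<n. real (min (i + 1) (j + 1))) = (real i + 1) * real n - real i * (real i + 1) / 2"
  using assms
proof (induction n rule: dec_induct)
  case base
  have "(\<Sum>j<Suc i. real (min (i + 1) (j + 1))) = (\<Sum>j<Suc i. real j + 1)"
    by (intro sum.cong) auto
  also have "\<dots> = (real i + 1) * (real i + 2) / 2"
    by (induction i) (auto simp: field_simps)
  finally show ?case by (simp add: field_simps)
next
  case (step n)
  then show ?case by (simp add: field_simps)
qed

lemma pak_cost_reversed: "pak_cost l w = (\<Sum>i<l. \<Sum>j<w. min (i + 1) (j + 1))"
proof -
  have "pak_cost l w = (\<Sum>i<l. \<Sum>j<w. min (l - i) (j + 1))"
    unfolding pak_cost_def
    by (intro sum.cong refl sum.nat_diff_reindex[symmetric, THEN trans]) (auto intro!: sum.cong)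
  also have "\<dots> = (\<Sum>i<l. \<Sum>j<w. min (i + 1) (j + 1))"
    by (subst sum.nat_diff_reindex[symmetric]) (auto intro!: sum.cong)
  finally show ?thesis .
qed

lemma pak_cost_commute: "pak_cost l w = pak_cost w l"
  unfolding pak_cost_def by (subst sum.swap) (simp add: min.commute)

lemma pak_cost_le_case:
  assumes "l \<le> n"
  shows "real (pak_cost l n) = real n * real l * (real l + 1) / 2 - (real l ^ 3 - real l) / 6"
proof -
  have "real (pak_cost l n) = (\<Sum>i<l. (\<Sum>j<n. real (min (i + 1) (j + 1))))"
    by (simp add: pak_cost_reversed)
  also have "\<dots> = (\<Sum>i<l. (real i + 1) * real n - real i * (real i + 1) / 2)"
    using assms by (intro sum.cong sum_min_row) auto
  also have "\<dots> = real n * real l * (real l + 1) / 2 - (real l ^ 3 - real l) / 6"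
    by (induction l) (auto simp: field_simps power3_eq_cube)
  finally show ?thesis .
qed

lemma pak_cost_eq_psi: "real (pak_cost a b) = psi a b"
proof (cases "a \<le> b")
  case True
  then show ?thesis using pak_cost_le_case[OF True] by (simp add: psi_def min_def max_def Let_def)
next
  case False
  then show ?thesis using pak_cost_le_case[of b a]
    by (simp add: psi_def min_def max_def Let_def pak_cost_commute[of a b])
qed

lemma snd_pak_transform_le:
  assumes "boxed a b D"
  shows "real (snd (pak_transform D)) \<le> psi a b"
  using pak_cost_mono[OF bounding_box(2,3)[OF assms]]
  by (simp add: pak_transform_eq[OF assms] flip: pak_cost_eq_psi)

lemma snd_pak_transform_full:
  assumes "boxed a b D" "D (a - 1, b - 1) \<noteq> 0"
  shows "real (snd (pak_transform D)) = psi a b"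
proof -
  have "a - 1 < bounding_length D" "b - 1 < bounding_width D"
    using boxedD[OF bounding_box(1)[OF assms(1)], of "a - 1" "b - 1"] assms(2) by (meson not_le)+
  then have "bounding_length D = a" "bounding_width D = b"
    using bounding_box(2,3)[OF assms(1)] by auto
  then show ?thesis
    by (simp add: pak_transform_eq[OF assms(1)] pak_cost_eq_psi)
qed

section \<open>Rejection sampling\<close>

text \<open>Both masses sum to 1, so a pointwise inequality leaves no room for a strict one. This
  suits a loop defined as a fixed point, since unfolding it yields lower bounds for its
  masses.\<close>

lemma pmf_eqI_le:
  assumes "\<And>x. pmf M x \<le> pmf N x"
  shows "M = N"
  using pmf_neq_exists_less[of N M] assms by (metis not_le)

text \<open>Closed form of the loop: a geometric number \<open>k\<close> of rejections, and
  independently an accepted sample from the conditional law. The accepted trial is charged too,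
  hence \<open>k + 1\<close>.\<close>

definition run_pmf :: "'d pmf \<Rightarrow> ('d \<Rightarrow> bool) \<Rightarrow> nat \<Rightarrow> ('d \<times> nat) pmf" where
  "run_pmf M P K = map_pmf (\<lambda>(k, D). (D, K * (k + 1)))
     (pair_pmf (geometric_pmf (measure_pmf.prob M {D. P D})) (cond_pmf M {D. P D}))"

lemma spmf_repeat_until_ge:
  fixes M :: "'d pmf" and K :: nat
  defines "M' \<equiv> map_pmf (\<lambda>D. (D, K)) M"
  assumes "P D"
  shows "spmf (repeat_until M' P) (D, K * (k + 1)) \<ge> (1 - measure_pmf.prob M {D. P D}) ^ k * pmf M D"
proof -
  define Q where "Q = repeat_until M' P"
  define p where "p = measure_pmf.prob M {D. P D}"
  define shift where "shift = (\<lambda>(D' :: 'd, t'). (D', K + t'))"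
  have Q: "Q = bind_pmf M (\<lambda>D. if P D then return_spmf (D, K) else map_spmf shift Q)"
    unfolding Q_def M'_def shift_def
    by (subst repeat_until.simps) (simp add: bind_map_pmf)
  have inj: "inj shift" by (auto simp: inj_on_def shift_def)
  have rec: "spmf Q (D, s) = (\<integral>D'. (if P D' then indicator {D} D' * indicator {K} s
      else spmf (map_spmf shift Q) (D, s)) \<partial>measure_pmf M)" for s
    by (subst Q, subst pmf_bind) (auto intro!: Bochner_Integration.integral_cong simp: indicator_def)
  show ?thesis unfolding Q_def[symmetric] p_def[symmetric]
  proof (induction k)
    case 0
    have "pmf M D = (\<integral>D'. indicator {D} D' \<partial>measure_pmf M)"
      by (simp add: pmf.rep_eq)
    also have "\<dots> \<le> spmf Q (D, K)" unfolding rec using assms(2)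
      by (intro integral_mono measure_pmf.integrable_const_bound[where B = 1])
        (auto simp: indicator_def pmf_le_1)
    finally show ?case by simp
  next
    case (Suc k)
    have s: "(D, K * (Suc k + 1)) = shift (D, K * (k + 1))"
      by (simp add: shift_def)
    \<comment> \<open>Restricting the recursion to a rejected first trial, which has probability
      \<open>1 - p\<close> and shifts the cost by \<open>K\<close>, bounds the mass from
      below.\<close>
    have "(1 - p) ^ Suc k * pmf M D = (1 - p) * ((1 - p) ^ k * pmf M D)" by simp
    also have "\<dots> \<le> (1 - p) * spmf Q (D, K * (k + 1))"
      using Suc by (intro mult_left_mono) (auto simp: p_def)
    also have "\<dots> = (\<integral>D'. indicator (- {D. P D}) D' * spmf Q (D, K * (k + 1)) \<partial>measure_pmf M)"
      using measure_pmf.prob_compl[of "{D. P D}" M]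
      by (simp add: p_def Compl_eq_Diff_UNIV)
    also have "\<dots> \<le> spmf Q (D, K * (Suc k + 1))"
      unfolding rec[of "K * (Suc k + 1)"] unfolding s spmf_map_inj'[OF inj]
      by (intro integral_mono measure_pmf.integrable_const_bound[where B = 1])
        (auto simp: indicator_def pmf_le_1)
    finally show ?case .
  qed
qed

text \<open>Since \<open>run_pmf\<close> has total mass 1, it suffices to compare masses from below,
  and almost sure termination comes out as part of the equality.\<close>

lemma repeat_until_eq:
  fixes M :: "'d pmf" and K :: nat
  assumes K: "0 < K" and p: "0 < measure_pmf.prob M {D. P D}"
  shows "repeat_until (map_pmf (\<lambda>D. (D, K)) M) P = spmf_of_pmf (run_pmf M P K)"
proof (rule pmf_eqI_le[symmetric])
  fix x :: "('d \<times> nat) option"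
  define p where "p = measure_pmf.prob M {D. P D}"
  have ne: "set_pmf M \<inter> {D. P D} \<noteq> {}"
    using p by (metis measure_pmf_zero_iff less_irrefl)
  have p01: "0 < p" "p \<le> 1" using p by (auto simp: p_def)
  show "pmf (spmf_of_pmf (run_pmf M P K)) x \<le> pmf (repeat_until (map_pmf (\<lambda>D. (D, K)) M) P) x"
  proof (cases x)
    case (Some y)
    show ?thesis
    proof (cases "y \<in> set_pmf (run_pmf M P K)")
      case True
      then obtain k D where y: "y = (D, K * (k + 1))" and PD: "P D" 
        by (auto simp: run_pmf_def ne)
      \<comment> \<open>Positive cost per trial makes the total cost determine the number of
        rejections, so each outcome has one preimage.\<close>
      have inj: "inj (\<lambda>(k, D :: 'd). (D, K * (k + 1)))"
        using K by (auto simp: inj_on_def)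
      have "pmf (run_pmf M P K) y = (1 - p) ^ k * p * (pmf M D / p)"
        using pmf_map_inj'[OF inj, of "pair_pmf (geometric_pmf p) (cond_pmf M {D. P D})" "(k, D)"] p01 PD ne
        by (simp add: run_pmf_def y pmf_pair pmf_cond flip: p_def)
      also have "\<dots> \<le> spmf (repeat_until (map_pmf (\<lambda>D. (D, K)) M) P) y"
        using spmf_repeat_until_ge[of P D M k K] PD p01 by (simp add: y p_def)
      finally show ?thesis using Some by simp
    next
      case False
      then show ?thesis using Some by (simp add: pmf_eq_0_set_pmf[THEN iffD2])
    qed
  qed simp
qed

lemma expectation_pair_pmf_sum:
  fixes f :: "'a \<Rightarrow> real" and g :: "'b \<Rightarrow> real"
  assumes "integrable (measure_pmf M) f" "integrable (measure_pmf N) g"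
  shows "integrable (measure_pmf (pair_pmf M N)) (\<lambda>(x, y). f x + g y)"
    and "measure_pmf.expectation (pair_pmf M N) (\<lambda>(x, y). f x + g y) =
      measure_pmf.expectation M f + measure_pmf.expectation N g"
proof -
  have f: "integrable (measure_pmf (pair_pmf M N)) (\<lambda>z. f (fst z))"
    using assms(1) integrable_map_pmf_eq[of fst "pair_pmf M N" f] by (simp add: map_fst_pair_pmf)
  have g: "integrable (measure_pmf (pair_pmf M N)) (\<lambda>z. g (snd z))"
    using assms(2) integrable_map_pmf_eq[of snd "pair_pmf M N" g] by (simp add: map_snd_pair_pmf)
  show "integrable (measure_pmf (pair_pmf M N)) (\<lambda>(x, y). f x + g y)"
    using f g by (simp add: case_prod_unfold)
  have "measure_pmf.expectation (pair_pmf M N) (\<lambda>z. f (fst z)) = measure_pmf.expectation M f"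
    using integral_map_pmf[of fst "pair_pmf M N" f] by (simp add: map_fst_pair_pmf)
  moreover have "measure_pmf.expectation (pair_pmf M N) (\<lambda>z. g (snd z)) = measure_pmf.expectation N g"
    using integral_map_pmf[of snd "pair_pmf M N" g] by (simp add: map_snd_pair_pmf)
  ultimately show "measure_pmf.expectation (pair_pmf M N) (\<lambda>(x, y). f x + g y) =
      measure_pmf.expectation M f + measure_pmf.expectation N g"
    using f g by (simp add: case_prod_unfold)
qed

text \<open>The number of rejections has mean \<open>(1 - p) / p\<close>, so the trials cost
  \<open>K / p\<close> on average; the bound on the cost of \<open>T\<close> over the support
  supplies integrability.\<close>

lemma repeat_until_post:
  fixes M :: "'d pmf" and K :: nat and T :: "'d \<Rightarrow> 'e \<times> nat" and P :: "'d \<Rightarrow> bool"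
  defines "S \<equiv> map_spmf (\<lambda>(D, t). case T D of (\<pi>, u) \<Rightarrow> (\<pi>, t + u))
      (repeat_until (map_pmf (\<lambda>D. (D, K)) M) P)"
  assumes K: "0 < K" and p: "0 < measure_pmf.prob M {D. P D}"
    and bounded: "\<And>D. D \<in> set_pmf M \<Longrightarrow> real (snd (T D)) \<le> B"
  shows "map_spmf fst S = spmf_of_pmf (map_pmf (fst \<circ> T) (cond_pmf M {D. P D}))" (is ?out)
    and "integrable (measure_spmf S) (\<lambda>r. real (snd r))" (is ?int)
    and "(\<integral>r. real (snd r) \<partial>measure_spmf S) = real K / measure_pmf.prob M {D. P D} +
      measure_pmf.expectation (cond_pmf M {D. P D}) (\<lambda>D. real (snd (T D)))" (is ?exp)
proof -
  define p where "p = measure_pmf.prob M {D. P D}"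
  define C where "C = cond_pmf M {D. P D}"
  have p01: "p \<in> {0<..1}" using assms(3) by (auto simp: p_def)
  have ne: "set_pmf M \<inter> {D. P D} \<noteq> {}"
    using assms(3) by (metis measure_pmf_zero_iff less_irrefl)
  define G where "G = (\<lambda>(k, D). (fst (T D), K * (k + 1) + snd (T D)))"
  have S: "S = spmf_of_pmf (map_pmf G (pair_pmf (geometric_pmf p) C))"
    unfolding S_def repeat_until_eq[OF K assms(3)]
    by (simp add: run_pmf_def map_pmf_comp p_def C_def G_def case_prod_unfold)
  have "map_spmf fst S = spmf_of_pmf (map_pmf (\<lambda>x. fst (T (snd x))) (pair_pmf (geometric_pmf p) C))"
    unfolding S by (simp add: map_pmf_comp G_def case_prod_unfold)
  also have "map_pmf (\<lambda>x. fst (T (snd x))) (pair_pmf (geometric_pmf p) C) =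
      map_pmf (fst \<circ> T) (map_pmf snd (pair_pmf (geometric_pmf p) C))"
    by (simp add: map_pmf_comp)
  finally show ?out by (simp add: map_snd_pair_pmf C_def)
  have f: "integrable (measure_pmf (geometric_pmf p)) (\<lambda>k. real K * (real k + 1))"
    using integrable_real_geometric_pmf[OF p01] by simp
  have g: "integrable (measure_pmf C) (\<lambda>D. real (snd (T D)))"
    using bounded set_cond_pmf[OF ne]
    by (intro measure_pmf.integrable_const_bound[where B = B]) (auto simp: AE_measure_pmf_iff C_def)
  have "(\<lambda>x. real (snd (G x))) = (\<lambda>(k, D). real K * (real k + 1) + real (snd (T D)))"
    by (auto simp: G_def algebra_simps)
  then show ?int ?exp
    using expectation_pair_pmf_sum[OF f g] expectation_geometric_pmf[OF p01] integrable_real_geometric_pmf[OF p01] p01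
    unfolding S by (simp_all add: C_def p_def field_simps)
qed

section \<open>Counting solutions of a linear equation\<close>

definition weighted_solutions :: "'c set \<Rightarrow> ('c \<Rightarrow> nat) \<Rightarrow> nat \<Rightarrow> ('c \<Rightarrow> nat) set" where
  "weighted_solutions I w m = {D. (\<forall>c. c \<notin> I \<longrightarrow> D c = 0) \<and> (\<Sum>c\<in>I. D c * w c) = m}"

lemma finite_weighted_solutions:
  assumes "finite I" "\<And>c. c \<in> I \<Longrightarrow> 0 < w c"
  shows "finite (weighted_solutions I w m)"
proof (rule finite_subset)
  show "finite {D. \<forall>c. (c \<in> I \<longrightarrow> D c \<in> {..m}) \<and> (c \<notin> I \<longrightarrow> D c = (0 :: nat))}"
    using assms(1) by (intro finite_set_of_finite_funs) auto
  have "D c \<le> m" if "D \<in> weighted_solutions I w m" "c \<in> I" for D c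
  proof -
    have "D c \<le> D c * w c" using assms(2)[OF that(2)] by simp
    also have "\<dots> \<le> (\<Sum>c\<in>I. D c * w c)" using assms(1) that(2) by (intro member_le_sum) auto
    finally show ?thesis using that(1) by (simp add: weighted_solutions_def)
  qed
  then show "weighted_solutions I w m \<subseteq> {D. \<forall>c. (c \<in> I \<longrightarrow> D c \<in> {..m}) \<and> (c \<notin> I \<longrightarrow> D c = 0)}"
    by (auto simp: weighted_solutions_def)
qed

text \<open>Solutions vanishing at \<open>c\<close> are solutions over \<open>I\<close>; lowering
  the entry at \<open>c\<close> by one matches the others with the solutions for
  \<open>m - w c\<close>.\<close>

lemma card_weighted_solutions_insert:
  assumes I: "finite I" "c \<notin> I" "\<And>c'. c' \<in> insert c I \<Longrightarrow> 0 < w c'" and m: "w c \<le> m"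
  shows "card (weighted_solutions (insert c I) w m) =
    card (weighted_solutions I w m) + card (weighted_solutions (insert c I) w (m - w c))"
proof -
  define up where "up = (\<lambda>D :: 'a \<Rightarrow> nat. D(c := D c + 1))"
  have sum_up: "(\<Sum>c'\<in>I. (D(c := k)) c' * w c') = (\<Sum>c'\<in>I. D c' * w c')" for D :: "'a \<Rightarrow> nat" and k
    using I(2) by (intro sum.cong) auto
  have zero: "{D \<in> weighted_solutions (insert c I) w m. D c = 0} = weighted_solutions I w m"
    using I by (auto simp: weighted_solutions_def) metis
  have pos: "{D \<in> weighted_solutions (insert c I) w m. D c \<noteq> 0} =
      up ` weighted_solutions (insert c I) w (m - w c)"
  proof (intro equalityI subsetI)
    fix D assume D: "D \<in> {D \<in> weighted_solutions (insert c I) w m. D c \<noteq> 0}"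
    define E where "E = D(c := D c - 1)"
    have "D = up E" using D by (auto simp: up_def E_def fun_eq_iff)
    moreover have "E \<in> weighted_solutions (insert c I) w (m - w c)"
    proof -
      have "(D c - 1) * w c + w c = D c * w c"
        using D by (cases "D c") auto
      then show ?thesis using D I unfolding weighted_solutions_def E_def
        by (auto simp: sum_up simp del: fun_upd_apply) auto
    qed
    ultimately show "D \<in> up ` weighted_solutions (insert c I) w (m - w c)" by blast
  next
    fix D assume "D \<in> up ` weighted_solutions (insert c I) w (m - w c)"
    then obtain E where E: "D = up E" "E \<in> weighted_solutions (insert c I) w (m - w c)" by blast
    have "(\<Sum>c'\<in>I. D c' * w c') = (\<Sum>c'\<in>I. E c' * w c')"
      unfolding E(1) up_def by (rule sum_up)
    then show "D \<in> {D \<in> weighted_solutions (insert c I) w m. D c \<noteq> 0}"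
      using E I m by (auto simp: weighted_solutions_def up_def)
  qed
  have "inj up" unfolding up_def
    by (rule injI) (metis (no_types, lifting) add_right_cancel ext fun_upd_apply)
  then have "card {D \<in> weighted_solutions (insert c I) w m. D c \<noteq> 0} =
      card (weighted_solutions (insert c I) w (m - w c))"
    unfolding pos by (intro card_image) (auto intro: inj_on_subset)
  moreover have "weighted_solutions (insert c I) w m =
      {D \<in> weighted_solutions (insert c I) w m. D c = 0} \<union>
      {D \<in> weighted_solutions (insert c I) w m. D c \<noteq> 0}" (is "_ = ?Z \<union> ?N")
    by blast
  moreover have "card (?Z \<union> ?N) = card ?Z + card ?N"
    using finite_weighted_solutions[of "insert c I" w m] I
    by (intro card_Un_disjoint) auto
  ultimately show ?thesis unfolding zero by metis
qed

text \<open>Factoring \<open>1 - t ^ Suc d\<close> with \<open>t = 1 - w / m\<close> leaves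
  \<open>w\<close> times a geometric sum whose \<open>d + 1\<close> terms tend to 1.\<close>

lemma tendsto_backward_difference_power:
  fixes w d :: nat
  shows "(\<lambda>m. (real m ^ Suc d - (real m - real w) ^ Suc d) / real m ^ d) \<longlonglongrightarrow> real w * real (Suc d)"
proof -
  have lim: "(\<lambda>m. 1 - real w / real m) \<longlonglongrightarrow> 1"
    using tendsto_diff[OF tendsto_const lim_const_over_n[of "real w"]] by simp
  have "(\<lambda>m. real w * (\<Sum>k<Suc d. (1 - real w / real m) ^ k)) \<longlonglongrightarrow> real w * (\<Sum>k<Suc d. 1 ^ k)"
    by (intro tendsto_mult tendsto_const tendsto_sum tendsto_power lim)
  then have "(\<lambda>m. real w * (\<Sum>k<Suc d. (1 - real w / real m) ^ k)) \<longlonglongrightarrow> real w * real (Suc d)"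
    by simp
  moreover have "\<forall>\<^sub>F m in sequentially. real w * (\<Sum>k<Suc d. (1 - real w / real m) ^ k) =
      (real m ^ Suc d - (real m - real w) ^ Suc d) / real m ^ d"
    using eventually_gt_at_top[of 0]
  proof eventually_elim
    case (elim m)
    define t where "t = 1 - real w / real m"
    have t: "real m - real w = real m * t" "real w = real m * (1 - t)"
      using elim by (simp_all add: t_def field_simps)
    have "(real m ^ Suc d - (real m - real w) ^ Suc d) / real m ^ d = real m * (1 - t ^ Suc d)"
      unfolding t(1) using elim by (simp add: power_mult_distrib field_simps)
    also have "1 - t ^ Suc d = (1 - t) * (\<Sum>k<Suc d. t ^ k)"
      by (rule one_diff_power_eq)
    finally show ?case unfolding t_def[symmetric] using t(2) by (metis mult.assoc)
  qed
  ultimately show ?thesis by (rule Lim_transform_eventually)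
qed

text \<open>A discrete Stolz--Cesaro argument along the residue classes modulo \<open>w\<close>.\<close>

lemma tendsto_summation_step:
  fixes f g :: "nat \<Rightarrow> real" and w d :: nat
  assumes f: "(\<lambda>m. f m / real m ^ d) \<longlonglongrightarrow> C" and w: "0 < w"
    and g: "\<And>m. w \<le> m \<Longrightarrow> g m = f m + g (m - w)"
  shows "(\<lambda>m. g m / real m ^ Suc d) \<longlonglongrightarrow> C / (real w * real (Suc d))"
proof -
  \<comment> \<open>For \<open>g m\<close> close to \<open>L * m ^ Suc d\<close>, the backward
    difference is about \<open>L * w * (d + 1) * m ^ d\<close>; matching it with
    \<open>C * m ^ d\<close> gives \<open>L\<close>. The error \<open>h\<close> obeys the recursion
    of \<open>g\<close>, driven by \<open>e\<close>, which tends to 0.\<close>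
  define L where "L = C / (real w * real (Suc d))"
  define h where "h m = g m - L * real m ^ Suc d" for m
  define e where "e m = f m / real m ^ d - L * ((real m ^ Suc d - (real m - real w) ^ Suc d) / real m ^ d)" for m
  have "e \<longlonglongrightarrow> C - L * (real w * real (Suc d))"
    unfolding e_def by (intro tendsto_diff tendsto_mult tendsto_const f tendsto_backward_difference_power)
  then have e: "e \<longlonglongrightarrow> 0"
    using w by (simp add: L_def)
  have rec: "h m = h (m - w) + e m * real m ^ d" if "w \<le> m" for m
    using that w g[OF that] by (simp add: h_def e_def of_nat_diff field_simps)
  have "(\<lambda>m. h m / real m ^ Suc d) \<longlonglongrightarrow> 0"
  proof (rule tendstoI)
    fix r :: real assume "0 < r"
    define \<delta> where "\<delta> = r / 2"
    have \<delta>: "0 < \<delta>" using \<open>0 < r\<close> by (simp add: \<delta>_def)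
    obtain M where M: "\<And>m. M \<le> m \<Longrightarrow> \<bar>e m\<bar> < \<delta>"
      using tendstoD[OF e \<delta>] by (auto simp: eventually_sequentially dist_real_def)
    define K where "K = (\<Sum>k<M + w. \<bar>h k\<bar>)"
    \<comment> \<open>\<open>K\<close> absorbs the start of all residue classes. In the induction
      \<open>m ^ Suc d\<close> pays for the new term because
      \<open>(m - w) ^ Suc d + m ^ d \<le> m ^ Suc d\<close> when
      \<open>1 \<le> w \<le> m\<close>.\<close>
    have bound: "\<bar>h m\<bar> \<le> K + \<delta> * real m ^ Suc d" for m
    proof (induction m rule: less_induct)
      case (less m)
      show ?case
      proof (cases "m < M + w")
        case True
        then have "\<bar>h m\<bar> \<le> K" unfolding K_def by (intro member_le_sum) auto
        also have "\<dots> \<le> K + \<delta> * real m ^ Suc d" using \<delta> by simp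
        finally show ?thesis .
      next
        case False
        then have "\<bar>h m\<bar> \<le> \<bar>h (m - w)\<bar> + \<bar>e m\<bar> * real m ^ d"
          using rec[of m] abs_triangle_ineq[of "h (m - w)" "e m * real m ^ d"] by (simp add: abs_mult)
        also have "\<dots> \<le> (K + \<delta> * real (m - w) ^ Suc d) + \<delta> * real m ^ d"
          using False w M[of m] by (intro add_mono less.IH mult_right_mono) auto
        also have "\<dots> = K + \<delta> * (real (m - w) * real (m - w) ^ d + real m ^ d)"
          by (simp add: algebra_simps)
        also have "\<dots> \<le> K + \<delta> * (real (m - w) * real m ^ d + real m ^ d)"
          using \<delta> by (intro add_mono mult_left_mono power_mono) auto
        also have "\<dots> = K + \<delta> * ((real (m - w) + 1) * real m ^ d)"
          by (simp add: algebra_simps)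
        also have "\<dots> \<le> K + \<delta> * (real m * real m ^ d)"
          using \<delta> False w by (intro add_mono mult_left_mono mult_right_mono) auto
        finally show ?thesis by simp
      qed
    qed
    have "(\<lambda>m. K / real m) \<longlonglongrightarrow> 0" by (rule lim_const_over_n)
    then have "\<forall>\<^sub>F m in sequentially. \<bar>K / real m\<bar> < \<delta>"
      using tendstoD[of "\<lambda>m. K / real m" 0 sequentially \<delta>] \<delta> by (simp add: dist_real_def)
    then show "\<forall>\<^sub>F m in sequentially. dist (h m / real m ^ Suc d) 0 < r"
      using eventually_gt_at_top[of 0]
    proof eventually_elim
      case (elim m)
      have "K \<ge> 0" by (simp add: K_def sum_nonneg)
      have "real m \<le> real m ^ Suc d" using elim(2) by (simp add: self_le_power)
      then have "K / real m ^ Suc d \<le> K / real m"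
        using elim(2) \<open>K \<ge> 0\<close> by (intro divide_left_mono) auto
      then have "K / real m ^ Suc d < \<delta>" using elim(1) by linarith
      moreover have "\<bar>h m\<bar> / real m ^ Suc d \<le> (K + \<delta> * real m ^ Suc d) / real m ^ Suc d"
        by (intro divide_right_mono bound) auto
      moreover have "(K + \<delta> * real m ^ Suc d) / real m ^ Suc d = K / real m ^ Suc d + \<delta>"
        using elim(2) by (simp add: add_divide_distrib)
      ultimately have "\<bar>h m\<bar> / real m ^ Suc d < r" unfolding \<delta>_def by linarith
      then show ?case by (simp add: dist_real_def del: power_Suc)
    qed
  qed
  then have "(\<lambda>m. h m / real m ^ Suc d + L) \<longlonglongrightarrow> 0 + L"
    by (intro tendsto_add tendsto_const)
  moreover have "\<forall>\<^sub>F m in sequentially. h m / real m ^ Suc d + L = g m / real m ^ Suc d"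
    using eventually_gt_at_top[of 0]
    by eventually_elim (simp add: h_def field_simps)
  ultimately show ?thesis unfolding L_def[symmetric] by (simp add: Lim_transform_eventually)
qed

text \<open>The cell of weight 1 starts the induction: alone it has exactly one solution for every
  \<open>m\<close>, so no residue class is left out. Every further cell raises the degree by one and
  divides the leading constant by its weight and by the new degree.\<close>

lemma tendsto_card_weighted_solutions_insert:
  assumes "finite J" "c \<notin> J" "w c = 1" "\<And>c'. c' \<in> J \<Longrightarrow> 0 < w c'"
  shows "(\<lambda>m. real (card (weighted_solutions (insert c J) w m)) / real m ^ card J)
    \<longlonglongrightarrow> 1 / (fact (card J) * real (\<Prod>c'\<in>insert c J. w c'))"
  using assms(1,2,4)
proof (induction J rule: finite_induct)
  case empty
  have "weighted_solutions {c} w m = {(\<lambda>_. 0)(c := m)}" for m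
    using assms(3) by (auto simp: weighted_solutions_def fun_eq_iff)
  then show ?case using assms(3) by simp
next
  case (insert c' J)
  have "(\<lambda>m. real (card (weighted_solutions (insert c' (insert c J)) w m)) / real m ^ Suc (card J))
    \<longlonglongrightarrow> 1 / (fact (card J) * real (\<Prod>c'\<in>insert c J. w c')) / (real (w c') * real (Suc (card J)))"
  proof (rule tendsto_summation_step)
    show "(\<lambda>m. real (card (weighted_solutions (insert c J) w m)) / real m ^ card J)
      \<longlonglongrightarrow> 1 / (fact (card J) * real (\<Prod>c'\<in>insert c J. w c'))"
      using insert by auto
    show "0 < w c'" using insert.prems by auto
    show "real (card (weighted_solutions (insert c' (insert c J)) w m)) =
      real (card (weighted_solutions (insert c J) w m)) +
      real (card (weighted_solutions (insert c' (insert c J)) w (m - w c')))" if "w c' \<le> m" for m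
    proof -
      have "0 < w c''" if "c'' \<in> insert c' (insert c J)" for c''
        using that insert.prems assms(3) by auto
      moreover have "c' \<notin> insert c J" "finite (insert c J)" using insert by auto
      ultimately show ?thesis
        using card_weighted_solutions_insert[of "insert c J" c' w m] that by simp
    qed
  qed
  moreover have "(\<Prod>x\<in>insert c (insert c' J). w x) = w c' * (\<Prod>x\<in>insert c J. w x)"
    using insert by auto
  ultimately show ?case
    using insert by (simp add: insert_commute mult_ac del: prod.insert of_nat_Suc)
qed

lemma tendsto_card_weighted_solutions:
  assumes "finite I" "c \<in> I" "w c = 1" "\<And>c'. c' \<in> I \<Longrightarrow> 0 < w c'"
  shows "(\<lambda>m. real (card (weighted_solutions I w m)) / real m ^ (card I - 1))
    \<longlonglongrightarrow> 1 / (fact (card I - 1) * real (\<Prod>c\<in>I. w c))"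
  using tendsto_card_weighted_solutions_insert[of "I - {c}" c w] assms
  by (simp add: insert_absorb)

section \<open>Size distribution near the tuned parameter\<close>

locale weighted_cells =
  fixes I :: "'c set" and w :: "'c \<Rightarrow> nat" and c\<^sub>0 :: 'c
  assumes finite_cells: "finite I"
    and unit_cell: "c\<^sub>0 \<in> I" "w c\<^sub>0 = 1"
    and weight_pos: "c \<in> I \<Longrightarrow> 0 < w c"
begin

definition \<alpha> :: nat where "\<alpha> = card I"

definition tuned :: "nat \<Rightarrow> real" where "tuned n = 1 - real \<alpha> / real n"

text \<open>Taken as a formula, so that the limits are statements about real sequences;
  \<open>prob_size\<close> later identifies it with the law of the size.\<close>

definition size_prob :: "nat \<Rightarrow> nat \<Rightarrow> real" where
  "size_prob n m = real (card (weighted_solutions I w m)) * tuned n ^ m * (\<Prod>c\<in>I. 1 - tuned n ^ w c)"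

lemma alpha_pos: "0 < \<alpha>"
  using finite_cells unit_cell(1) by (auto simp: \<alpha>_def card_gt_0_iff)

lemma tuned_bounds:
  assumes "\<alpha> < n"
  shows "0 < tuned n" "tuned n < 1"
  using assms alpha_pos by (auto simp: tuned_def)

lemma tendsto_tuned: "tuned \<longlonglongrightarrow> 1"
  using tendsto_diff[OF tendsto_const lim_const_over_n[of "real \<alpha>"], of 1] by (simp add: tuned_def[abs_def])

lemma one_minus_tuned_power:
  assumes "0 < n"
  shows "real n * (1 - tuned n ^ k) = real \<alpha> * (\<Sum>i<k. tuned n ^ i)"
proof -
  have "real n * (1 - tuned n) = real \<alpha>"
    using assms by (simp add: tuned_def)
  then show ?thesis by (metis one_diff_power_eq mult.assoc)
qed

lemma tendsto_one_minus_tuned_power: "(\<lambda>n. real n * (1 - tuned n ^ k)) \<longlonglongrightarrow> real \<alpha> * real k"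
proof -
  have "(\<lambda>n. real \<alpha> * (\<Sum>i<k. tuned n ^ i)) \<longlonglongrightarrow> real \<alpha> * (\<Sum>i<k. 1 ^ i)"
    by (intro tendsto_intros tendsto_tuned)
  then have "(\<lambda>n. real \<alpha> * (\<Sum>i<k. tuned n ^ i)) \<longlonglongrightarrow> real \<alpha> * real k" by simp
  moreover have "\<forall>\<^sub>F n in sequentially. real \<alpha> * (\<Sum>i<k. tuned n ^ i) = real n * (1 - tuned n ^ k)"
    using eventually_gt_at_top[of 0] by eventually_elim (simp add: one_minus_tuned_power)
  ultimately show ?thesis by (rule Lim_transform_eventually)
qed

text \<open>Write the power as \<open>(tuned n ^ n) powr (m n / n)\<close>: the base tends to
  \<open>exp (- \<alpha>)\<close>, the exponent to \<open>u\<close>.\<close>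

lemma tendsto_tuned_power:
  assumes "(\<lambda>n. real (m n) / real n) \<longlonglongrightarrow> u"
  shows "(\<lambda>n. tuned n ^ m n) \<longlonglongrightarrow> exp (- real \<alpha> * u)"
proof -
  have "(\<lambda>n. (1 + (- real \<alpha>) / real n) ^ n) \<longlonglongrightarrow> exp (- real \<alpha>)"
    by (rule tendsto_exp_limit_sequentially)
  then have "(\<lambda>n. tuned n ^ n) \<longlonglongrightarrow> exp (- real \<alpha>)"
    by (simp add: tuned_def)
  then have "(\<lambda>n. (tuned n ^ n) powr (real (m n) / real n)) \<longlonglongrightarrow> exp (- real \<alpha>) powr u"
    using assms by (intro tendsto_powr) auto
  moreover have "\<forall>\<^sub>F n in sequentially. (tuned n ^ n) powr (real (m n) / real n) = tuned n ^ m n"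
    using eventually_gt_at_top[of \<alpha>]
  proof eventually_elim
    case (elim n)
    then show ?case using tuned_bounds[OF elim]
      by (simp add: powr_powr flip: powr_realpow)
  qed
  ultimately show ?thesis
    by (simp add: Lim_transform_eventually exp_powr_real)
qed

text \<open>The powers of \<open>n\<close> are distributed so that every factor can converge:
  \<alpha> of them scale the product, \<open>\<alpha> - 1\<close> turn \<open>m\<close> into
  \<open>m / n\<close>, and the one in excess stands on the left.\<close>

lemma size_prob_split:
  assumes "\<alpha> < n" "0 < m"
  shows "real n * size_prob n m =
    real (card (weighted_solutions I w m)) / real m ^ (\<alpha> - 1) * (real m / real n) ^ (\<alpha> - 1) *
    tuned n ^ m * (\<Prod>c\<in>I. real n * (1 - tuned n ^ w c))"
proof -
  have "real n ^ \<alpha> = real n * real n ^ (\<alpha> - 1)"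
    using alpha_pos by (metis power_eq_if less_numeral_extra(3))
  moreover have "(\<Prod>c\<in>I. real n * (1 - tuned n ^ w c)) = real n ^ \<alpha> * (\<Prod>c\<in>I. 1 - tuned n ^ w c)"
    by (simp only: prod.distrib prod_constant \<alpha>_def)
  ultimately show ?thesis
    using assms unfolding size_prob_def by (simp add: power_divide)
qed

lemma tendsto_count: "(\<lambda>m. real (card (weighted_solutions I w m)) / real m ^ (\<alpha> - 1))
    \<longlonglongrightarrow> 1 / (fact (\<alpha> - 1) * real (\<Prod>c\<in>I. w c))"
  using finite_cells unit_cell weight_pos unfolding \<alpha>_def by (rule tendsto_card_weighted_solutions)

lemma phi_alpha: "phi (real \<alpha>) = real \<alpha> ^ \<alpha> * exp (- real \<alpha>) / fact (\<alpha> - 1)"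
proof -
  have "Gamma (real \<alpha>) = fact (\<alpha> - 1)"
    using Gamma_fact[of "\<alpha> - 1", where 'a = real] alpha_pos by (simp add: of_nat_diff)
  moreover have "(real \<alpha> / exp 1) powr real \<alpha> = real \<alpha> ^ \<alpha> * exp (- real \<alpha>)"
    using alpha_pos by (simp add: powr_divide exp_powr_real powr_realpow exp_minus field_simps)
  ultimately show ?thesis by (simp add: phi_def)
qed

lemma phi_alpha_pos: "0 < phi (real \<alpha>)"
  using alpha_pos by (simp add: phi_alpha)

lemma local_limit:
  assumes m: "(\<lambda>n. real (m n) / real n) \<longlonglongrightarrow> u" and u: "0 < u"
  shows "(\<lambda>n. real n * size_prob n (m n)) \<longlonglongrightarrow>
    phi (real \<alpha>) * (u powr (real \<alpha> - 1) * exp (- real \<alpha> * (u - 1)))"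
proof -
  define count where "count k = real (card (weighted_solutions I w k)) / real k ^ (\<alpha> - 1)" for k
  have "\<forall>\<^sub>F n in sequentially. u / 2 < real (m n) / real n"
    using order_tendstoD(1)[OF m, of "u / 2"] u by simp
  then have ev: "\<forall>\<^sub>F n in sequentially. u / 2 * real n < real (m n)"
    using eventually_gt_at_top[of 0] by eventually_elim (simp add: field_simps)
  \<comment> \<open>The asymptotic count is a limit in the size, so \<open>m n\<close> itself has to
    tend to infinity; positivity of \<open>u\<close> ensures it.\<close>
  have "filterlim (\<lambda>n. u / 2 * real n) at_top sequentially"
    using u by (intro filterlim_tendsto_pos_mult_at_top[OF tendsto_const _ filterlim_real_sequentially]) auto
  then have "filterlim (\<lambda>n. real (m n)) at_top sequentially"
    by (rule filterlim_at_top_mono) (use ev in \<open>eventually_elim, simp\<close>)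
  then have m_top: "filterlim m at_top sequentially"
    by (simp add: filterlim_sequentially_iff_filterlim_real)
  have "(\<lambda>n. count (m n) * (real (m n) / real n) ^ (\<alpha> - 1) * tuned n ^ m n *
      (\<Prod>c\<in>I. real n * (1 - tuned n ^ w c))) \<longlonglongrightarrow>
    1 / (fact (\<alpha> - 1) * real (\<Prod>c\<in>I. w c)) * u ^ (\<alpha> - 1) * exp (- real \<alpha> * u) *
      (\<Prod>c\<in>I. real \<alpha> * real (w c))"
    using filterlim_compose[OF tendsto_count m_top] unfolding count_def
    by (intro tendsto_mult tendsto_power tendsto_prod m tendsto_tuned_power tendsto_one_minus_tuned_power)
  moreover have "\<forall>\<^sub>F n in sequentially. count (m n) * (real (m n) / real n) ^ (\<alpha> - 1) * tuned n ^ m n *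
      (\<Prod>c\<in>I. real n * (1 - tuned n ^ w c)) = real n * size_prob n (m n)"
    using eventually_gt_at_top[of \<alpha>] eventually_compose_filterlim[OF eventually_gt_at_top[of 0] m_top]
    by eventually_elim (simp add: size_prob_split count_def)
  ultimately have "(\<lambda>n. real n * size_prob n (m n)) \<longlonglongrightarrow>
    1 / (fact (\<alpha> - 1) * real (\<Prod>c\<in>I. w c)) * u ^ (\<alpha> - 1) * exp (- real \<alpha> * u) *
      (\<Prod>c\<in>I. real \<alpha> * real (w c))"
    by (rule Lim_transform_eventually)
  also have "1 / (fact (\<alpha> - 1) * real (\<Prod>c\<in>I. w c)) * u ^ (\<alpha> - 1) * exp (- real \<alpha> * u) *
      (\<Prod>c\<in>I. real \<alpha> * real (w c)) = phi (real \<alpha>) * (u powr (real \<alpha> - 1) * exp (- real \<alpha> * (u - 1)))"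
  proof -
    have "(\<Prod>c\<in>I. real (w c)) \<noteq> 0"
      using weight_pos finite_cells by auto
    moreover have "u powr (real \<alpha> - 1) = u ^ (\<alpha> - 1)"
      using u alpha_pos powr_realpow[OF u, of "\<alpha> - 1"] by (simp add: of_nat_diff)
    moreover have "exp (- real \<alpha> * u) = exp (- real \<alpha>) * exp (- real \<alpha> * (u - 1))"
      by (simp add: exp_add[symmetric] algebra_simps)
    moreover have "(\<Prod>c\<in>I. real \<alpha> * real (w c)) = real \<alpha> ^ \<alpha> * (\<Prod>c\<in>I. real (w c))"
      by (simp add: prod.distrib \<alpha>_def)
    ultimately show ?thesis
      by (simp add: phi_alpha)
  qed
  finally show ?thesis .
qed

lemma size_prob_nonneg: "\<alpha> < n \<Longrightarrow> 0 \<le> size_prob n m"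
  using tuned_bounds[of n] unfolding size_prob_def
  by (intro mult_nonneg_nonneg prod_nonneg) (auto intro: power_le_one)

text \<open>Uniform domination for the window integral. The constant multiplies a bound on the
  convergent count, \<open>2 ^ (\<alpha> - 1)\<close> from \<open>m \<le> 2 * n\<close>, 1 for the
  power of \<open>tuned n\<close>, and \<open>\<alpha> * w c\<close> for each scaled factor.\<close>

lemma size_prob_bound:
  obtains B where "0 \<le> B" "\<And>n m. \<alpha> < n \<Longrightarrow> 0 < m \<Longrightarrow> m \<le> 2 * n \<Longrightarrow> real n * size_prob n m \<le> B"
proof -
  obtain K where K: "\<And>m. \<bar>real (card (weighted_solutions I w m)) / real m ^ (\<alpha> - 1)\<bar> \<le> K"
    using convergent_imp_Bseq[OF convergentI[OF tendsto_count]] by (auto simp: Bseq_def)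
  have K0: "0 \<le> K" using K[of 0] by linarith
  show ?thesis
  proof (rule that)
    show "0 \<le> K * 2 ^ (\<alpha> - 1) * 1 * (\<Prod>c\<in>I. real \<alpha> * real (w c))"
      using K0 by (auto intro!: mult_nonneg_nonneg prod_nonneg)
    fix n m assume n: "\<alpha> < n" and m: "0 < m" "m \<le> 2 * n"
    note x = tuned_bounds[OF n]
    define r where "r c = real n * (1 - tuned n ^ w c)" for c
    have prods: "0 \<le> r c" "r c \<le> real \<alpha> * real (w c)" for c
    proof -
      show "0 \<le> r c"
        unfolding r_def using x by (intro mult_nonneg_nonneg) (auto intro: power_le_one)
      have "(\<Sum>i<w c. tuned n ^ i) \<le> (\<Sum>i<w c. 1)"
        using x by (intro sum_mono power_le_one) auto
      then show "r c \<le> real \<alpha> * real (w c)"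
        unfolding r_def using n by (simp add: one_minus_tuned_power mult_left_mono)
    qed
    show "real n * size_prob n m \<le> K * 2 ^ (\<alpha> - 1) * 1 * (\<Prod>c\<in>I. real \<alpha> * real (w c))"
      unfolding size_prob_split[OF n m(1)] r_def[symmetric]
    proof (intro mult_mono prod_mono power_mono conjI prods)
      show "real (card (weighted_solutions I w m)) / real m ^ (\<alpha> - 1) \<le> K" using K[of m] by linarith
      show "real m / real n \<le> 2" using m n by (simp add: field_simps flip: of_nat_mult)
      show "tuned n ^ m \<le> 1" using x by (intro power_le_one) auto
    qed (use x K0 in \<open>auto intro!: mult_nonneg_nonneg prod_nonneg prods\<close>)
  qed
qed

text \<open>The sum is the integral of a step function: with \<open>s = m / n - 1\<close>, size
  \<open>m\<close> owns an interval of length \<open>1 / n\<close> on which the function is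
  \<open>n * size_prob n m\<close>. The local limit gives its pointwise limit.\<close>

lemma window_limit:
  fixes \<epsilon> :: real
  assumes \<epsilon>: "0 < \<epsilon>" "\<epsilon> < 1"
  shows "(\<lambda>n. \<Sum>m | real m \<in> size_window n \<epsilon>. size_prob n m) \<longlonglongrightarrow> Phi (real \<alpha>) \<epsilon>"
proof -
  define g where "g s = phi (real \<alpha>) * ((1 + s) powr (real \<alpha> - 1) * exp (- real \<alpha> * s))" for s
  define W where "W n = {m. real m \<in> size_window n \<epsilon>}" for n
  define cell where "cell n m = {real m / real n - 1..<(real m + 1) / real n - 1}" for n m :: nat
  define step where "step n s = (\<Sum>m\<in>W n. real n * size_prob n m * indicator (cell n m) s)" for n s
  have W: "m \<in> W n \<longleftrightarrow> real n * (1 - \<epsilon>) \<le> real m \<and> real m \<le> real n * (1 + \<epsilon>)" for m n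
    by (simp add: W_def size_window_def)
  have W_bounds: "0 < m" "m \<le> 2 * n" if "m \<in> W n" "0 < n" for m n
  proof -
    have "0 < real n * (1 - \<epsilon>)" "real n * (1 + \<epsilon>) \<le> real n * 2"
      using that(2) \<epsilon> by auto
    then have "0 < real m" "real m \<le> real n * 2" using that(1) unfolding W by linarith+
    then show "0 < m" "m \<le> 2 * n" by linarith+
  qed
  have fin: "finite (W n)" for n
    by (rule finite_subset[of _ "{..nat \<lceil>real n * (1 + \<epsilon>)\<rceil>}"]) (auto simp: W le_nat_iff, linarith)
  have cell: "s \<in> cell n m \<longleftrightarrow> m = nat \<lfloor>real n * (1 + s)\<rfloor> \<and> - 1 \<le> s" if "0 < n" for n m s
  proof -
    have "s \<in> cell n m \<longleftrightarrow> real m \<le> real n * (1 + s) \<and> real n * (1 + s) < real m + 1"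
      using that by (auto simp: cell_def field_simps)
    also have "\<dots> \<longleftrightarrow> int m = \<lfloor>real n * (1 + s)\<rfloor>"
      unfolding eq_commute[of "int m"] floor_eq_iff by simp
    also have "\<dots> \<longleftrightarrow> m = nat \<lfloor>real n * (1 + s)\<rfloor> \<and> 0 \<le> \<lfloor>real n * (1 + s)\<rfloor>" by linarith
    also have "0 \<le> \<lfloor>real n * (1 + s)\<rfloor> \<longleftrightarrow> - 1 \<le> s"
      using that by (auto simp: zero_le_mult_iff)
    finally show ?thesis .
  qed
  have step: "step n s = (if - 1 \<le> s \<and> nat \<lfloor>real n * (1 + s)\<rfloor> \<in> W n
      then real n * size_prob n (nat \<lfloor>real n * (1 + s)\<rfloor>) else 0)" if "0 < n" for n s
    using fin[of n] unfolding step_def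
    by (auto simp: cell[OF that] indicator_def if_distrib cong: if_cong intro!: sum.neutral)
  obtain B where B: "0 \<le> B" "\<And>n m. \<alpha> < n \<Longrightarrow> 0 < m \<Longrightarrow> m \<le> 2 * n \<Longrightarrow> real n * size_prob n m \<le> B"
    by (rule size_prob_bound) blast
  \<comment> \<open>Domination is required at every index, while \<open>size_prob_bound\<close> asks
    for \<open>\<alpha> < n\<close>; the shift skips the small indices.\<close>
  define n0 where "n0 = Suc \<alpha>"
  have "(\<lambda>n. \<integral>s. step (n + n0) s \<partial>lborel) \<longlonglongrightarrow> (\<integral>s. indicator {-\<epsilon>..\<epsilon>} s * g s \<partial>lborel)"
  proof (rule integral_dominated_convergence)
    show "integrable lborel (\<lambda>s. B * indicator {-1..2 :: real} s :: real)" by simp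
    show "(\<lambda>s. indicator {-\<epsilon>..\<epsilon>} s * g s) \<in> borel_measurable lborel"
      unfolding g_def by measurable
    show "(\<lambda>s. step (n + n0) s) \<in> borel_measurable lborel" for n
      unfolding step_def cell_def by measurable
    show "AE s in lborel. norm (step (n + n0) s) \<le> B * indicator {-1..2} s" for n
    proof (rule AE_I2)
      fix s :: real
      define k where "k = n + n0"
      have k: "\<alpha> < k" "0 < k" by (auto simp: k_def n0_def)
      show "norm (step (n + n0) s) \<le> B * indicator {-1..2} s"
      proof (cases "- 1 \<le> s \<and> nat \<lfloor>real k * (1 + s)\<rfloor> \<in> W k")
        case True
        note b = W_bounds[OF conjunct2[OF True] k(2)]
        \<comment> \<open>Where the step function is nonzero, its size \<open>m\<close> is at most
          \<open>2 * k\<close>, so \<open>k * (1 + s) < m + 1 \<le> 3 * k\<close>; hence the right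
          end 2 of the dominating interval.\<close>
        have "real k * (1 + s) < real (nat \<lfloor>real k * (1 + s)\<rfloor>) + 1" by linarith
        also have "\<dots> \<le> real k * 3" using b(2) k(2) by linarith
        finally have "s \<le> 2" using k(2) by simp
        then show ?thesis
          using True B(2)[OF k(1) b] size_prob_nonneg[OF k(1)] step[OF k(2)] by (simp add: k_def)
      next
        case False
        then show ?thesis using B(1) step[OF k(2), of s] by (auto simp: k_def)
      qed
    qed
    \<comment> \<open>At the ends of the window the rounded size may fall on either side, so
      pointwise convergence is claimed only off these two points.\<close>
    have "AE s in lborel. s \<noteq> \<epsilon> \<and> s \<noteq> - \<epsilon>"
      using AE_lborel_singleton[of \<epsilon>] AE_lborel_singleton[of "- \<epsilon>"] by eventually_elim auto
    then show "AE s in lborel. (\<lambda>n. step (n + n0) s) \<longlonglongrightarrow> indicator {-\<epsilon>..\<epsilon>} s * g s"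
    proof eventually_elim
      case (elim s)
      have "(\<lambda>n. step n s) \<longlonglongrightarrow> indicator {-\<epsilon>..\<epsilon>} s * g s"
      proof (cases "s < - 1")
        case True
        have "\<forall>\<^sub>F n in sequentially. 0 = step n s"
          using eventually_gt_at_top[of 0] by eventually_elim (use True in \<open>simp add: step\<close>)
        then show ?thesis using True \<epsilon> by (auto intro: Lim_transform_eventually[OF tendsto_const])
      next
        case False
        define m where "m n = nat \<lfloor>real n * (1 + s)\<rfloor>" for n
        have m: "(\<lambda>n. real (m n) / real n) \<longlonglongrightarrow> 1 + s"
        proof (rule tendsto_sandwich)
          show "\<forall>\<^sub>F n in sequentially. (1 + s) - 1 / real n \<le> real (m n) / real n"
            using eventually_gt_at_top[of 0]
          proof eventually_elim
            case (elim n)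
            have "real n * (1 + s) - 1 \<le> real (m n)" unfolding m_def by linarith
            then have "(real n * (1 + s) - 1) / real n \<le> real (m n) / real n"
              by (intro divide_right_mono) auto
            then show ?case using elim by (simp add: diff_divide_distrib)
          qed
          show "\<forall>\<^sub>F n in sequentially. real (m n) / real n \<le> 1 + s"
            using eventually_gt_at_top[of 0]
          proof eventually_elim
            case (elim n)
            have "0 \<le> real n * (1 + s)" using False by simp
            then have "real (m n) \<le> real n * (1 + s)" unfolding m_def by linarith
            then show ?case using elim by (simp add: field_simps)
          qed
          show "(\<lambda>n. (1 + s) - 1 / real n) \<longlonglongrightarrow> 1 + s"
            using tendsto_diff[OF tendsto_const lim_const_over_n[of 1], of "1 + s"] by simp
        qed simp
        have W': "m n \<in> W n \<longleftrightarrow> 1 - \<epsilon> \<le> real (m n) / real n \<and> real (m n) / real n \<le> 1 + \<epsilon>" if "0 < n" for n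
          using that by (simp add: W field_simps)
        consider "s < - \<epsilon>" | "- \<epsilon> < s" "s < \<epsilon>" | "\<epsilon> < s" using elim by linarith
        then show ?thesis
        proof cases
          case 1
          have "\<forall>\<^sub>F n in sequentially. real (m n) / real n < 1 - \<epsilon>"
            using 1 by (intro order_tendstoD(2)[OF m]) simp
          then have "\<forall>\<^sub>F n in sequentially. 0 = step n s"
            using eventually_gt_at_top[of 0] by eventually_elim (simp add: step W' flip: m_def)
          then show ?thesis using 1 by (auto intro: Lim_transform_eventually[OF tendsto_const])
        next
          case 3
          have "\<forall>\<^sub>F n in sequentially. 1 + \<epsilon> < real (m n) / real n"
            using 3 by (intro order_tendstoD(1)[OF m]) simp
          then have "\<forall>\<^sub>F n in sequentially. 0 = step n s"
            using eventually_gt_at_top[of 0] by eventually_elim (simp add: step W' flip: m_def)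
          then show ?thesis using 3 by (auto intro: Lim_transform_eventually[OF tendsto_const])
        next
          case 2
          have "(\<lambda>n. real n * size_prob n (m n)) \<longlonglongrightarrow> indicator {-\<epsilon>..\<epsilon>} s * g s"
            using local_limit[OF m] 2 \<epsilon> by (simp add: g_def)
          moreover have "\<forall>\<^sub>F n in sequentially. 1 - \<epsilon> < real (m n) / real n"
            "\<forall>\<^sub>F n in sequentially. real (m n) / real n < 1 + \<epsilon>"
            using 2 by (auto intro!: order_tendstoD[OF m])
          then have "\<forall>\<^sub>F n in sequentially. real n * size_prob n (m n) = step n s"
            using eventually_gt_at_top[of 0]
            by eventually_elim (use 2 False in \<open>simp add: step W' flip: m_def\<close>)
          ultimately show ?thesis by (rule Lim_transform_eventually)
        qed
      qed
      then show ?case by (rule LIMSEQ_ignore_initial_segment)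
    qed
  qed
  moreover have "(\<integral>s. step n s \<partial>lborel) = (\<Sum>m\<in>W n. size_prob n m)" if "0 < n" for n
  proof -
    have le: "real m / real n - 1 \<le> (real m + 1) / real n - 1" for m
      using that by (simp add: divide_right_mono)
    have "(\<integral>s. indicator (cell n m) s \<partial>lborel) = 1 / real n" for m
      using le[of m] by (simp add: cell_def add_divide_distrib)
    moreover have "integrable lborel (indicator (cell n m) :: real \<Rightarrow> real)" for m
      using le[of m] by (simp add: cell_def)
    ultimately show ?thesis
      unfolding step_def using that by (subst Bochner_Integration.integral_sum) auto
  qed
  ultimately have "(\<lambda>n. \<Sum>m\<in>W (n + n0). size_prob (n + n0) m) \<longlonglongrightarrow> (\<integral>s. indicator {-\<epsilon>..\<epsilon>} s * g s \<partial>lborel)"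
    by (simp add: n0_def)
  then have "(\<lambda>n. \<Sum>m\<in>W n. size_prob n m) \<longlonglongrightarrow> (\<integral>s. indicator {-\<epsilon>..\<epsilon>} s * g s \<partial>lborel)"
    by (rule LIMSEQ_offset)
  also have "(\<integral>s. indicator {-\<epsilon>..\<epsilon>} s * g s \<partial>lborel) = integral {-\<epsilon>..\<epsilon>} g"
  proof -
    have "continuous_on {-\<epsilon>..\<epsilon>} g"
      unfolding g_def using \<epsilon> by (intro continuous_intros) auto
    then have "set_integrable lborel {-\<epsilon>..\<epsilon>} g"
      by (rule borel_integrable_atLeastAtMost')
    then show ?thesis
      using set_borel_integral_eq_integral(2)[of "{-\<epsilon>..\<epsilon>}" g] by (simp add: set_lebesgue_integral_def)
  qed
  also have "\<dots> = Phi (real \<alpha>) \<epsilon>"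
    by (simp add: g_def[abs_def] Phi_def phi_def)
  finally show ?thesis by (simp add: W_def)
qed

text \<open>This keeps the acceptance probability away from 0 in the limit. The integrand is
  continuous, nonnegative and equal to 1 at 0.\<close>

lemma Phi_alpha_pos:
  assumes "0 < \<epsilon>" "\<epsilon> < 1"
  shows "0 < Phi (real \<alpha>) \<epsilon>"
proof -
  let ?g = "\<lambda>s. (1 + s) powr (real \<alpha> - 1) * exp (- real \<alpha> * s)"
  have cont: "continuous_on {-\<epsilon>..\<epsilon>} ?g"
    using assms by (intro continuous_intros) auto
  have "0 \<le> integral {-\<epsilon>..\<epsilon>} ?g"
    by (intro integral_nonneg integrable_continuous_real cont) auto
  moreover have "integral {-\<epsilon>..\<epsilon>} ?g \<noteq> 0"
  proof
    assume "integral {-\<epsilon>..\<epsilon>} ?g = 0"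
    then have "\<forall>s\<in>{-\<epsilon>..\<epsilon>}. ?g s = 0"
      using assms cont by (subst (asm) integral_eq_0_iff) auto
    then have "?g 0 = 0" using assms by (metis atLeastAtMost_iff less_eq_real_def neg_le_0_iff_le)
    then show False by simp
  qed
  ultimately have "0 < phi (real \<alpha>) * integral {-\<epsilon>..\<epsilon>} ?g"
    using phi_alpha_pos by (intro mult_pos_pos) auto
  then show ?thesis
    by (simp add: Phi_def phi_def)
qed

end

section \<open>The sampler\<close>

abbreviation cells :: "nat \<Rightarrow> nat \<Rightarrow> (nat \<times> nat) set" where
  "cells a b \<equiv> {..<a} \<times> {..<b}"

definition cell_weight :: "nat \<times> nat \<Rightarrow> nat" where
  "cell_weight c = fst c + snd c + 1"

lemma cell_weight_pos [simp]: "0 < cell_weight c"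
  by (simp add: cell_weight_def)

definition diagram_pmf :: "nat \<Rightarrow> nat \<Rightarrow> real \<Rightarrow> array pmf" where
  "diagram_pmf a b x = Pi_pmf (cells a b) 0 (\<lambda>c. geometric_pmf (1 - x ^ cell_weight c))"

lemma gamma_M_eq: "gamma_M a b x = map_pmf (\<lambda>D. (D, a * b)) (diagram_pmf a b x)"
  by (simp add: gamma_M_def diagram_pmf_def cell_weight_def case_prod_unfold)

lemma boxed_iff: "boxed a b D \<longleftrightarrow> (\<forall>c. c \<notin> cells a b \<longrightarrow> D c = 0)"
  by (auto simp: boxed_def not_less)

lemma diagram_size_cells:
  "boxed a b D \<Longrightarrow> diagram_size D = (\<Sum>c\<in>cells a b. D c * cell_weight c)"
  by (simp add: diagram_size_boxed cell_weight_def case_prod_unfold)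

lemma weighted_solutions_cells:
  "weighted_solutions (cells a b) cell_weight m = {D. boxed a b D \<and> diagram_size D = m}"
  unfolding weighted_solutions_def boxed_iff[symmetric] using diagram_size_cells by auto

lemma pmf_diagram_pmf:
  assumes x: "0 < x" "x < 1"
  shows "pmf (diagram_pmf a b x) D =
    (if boxed a b D then x ^ diagram_size D * (\<Prod>c\<in>cells a b. 1 - x ^ cell_weight c) else 0)"
proof -
  have "pmf (geometric_pmf (1 - x ^ cell_weight c)) (D c) =
      x ^ (D c * cell_weight c) * (1 - x ^ cell_weight c)" for c
  proof -
    have "x ^ cell_weight c < 1" using x cell_weight_pos[of c] by (simp add: power_less_one_iff)
    then show ?thesis using x by (simp add: power_mult[symmetric] mult.commute)
  qed
  then have "(\<Prod>c\<in>cells a b. pmf (geometric_pmf (1 - x ^ cell_weight c)) (D c)) =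
      x ^ (\<Sum>c\<in>cells a b. D c * cell_weight c) * (\<Prod>c\<in>cells a b. 1 - x ^ cell_weight c)"
    by (simp add: prod.distrib power_sum)
  then show ?thesis
    unfolding diagram_pmf_def by (subst pmf_Pi) (simp_all only: finite_cartesian_product finite_lessThan
        boxed_iff[symmetric] diagram_size_cells cong: if_cong)
qed

lemma set_diagram_pmf:
  assumes "0 < x" "x < 1"
  shows "set_pmf (diagram_pmf a b x) = {D. boxed a b D}"
proof -
  define z where "z = (\<Prod>c\<in>cells a b. 1 - x ^ cell_weight c)"
  have "0 < z" unfolding z_def
    using assms by (intro prod_pos) (auto simp: power_less_one_iff)
  moreover have "pmf (diagram_pmf a b x) D = (if boxed a b D then x ^ diagram_size D * z else 0)" for D
    unfolding z_def by (rule pmf_diagram_pmf[OF assms])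
  ultimately show ?thesis
    using assms by (auto simp: set_pmf_iff split: if_splits)
qed

lemma measure_diagram_pmf_corner_zero:
  assumes "0 < x" "x < 1" "i < a" "j < b"
  shows "measure_pmf.prob (diagram_pmf a b x) {D. D (i, j) = 0} = 1 - x ^ (i + j + 1)"
proof -
  have "measure_pmf.prob (diagram_pmf a b x) {D. D (i, j) = 0} = pmf (map_pmf (\<lambda>D. D (i, j)) (diagram_pmf a b x)) 0"
    by (simp add: pmf_map vimage_def)
  also have "map_pmf (\<lambda>D. D (i, j)) (diagram_pmf a b x) = geometric_pmf (1 - x ^ (i + j + 1))"
    unfolding diagram_pmf_def using assms by (subst Pi_pmf_component) (auto simp: cell_weight_def)
  also have "pmf \<dots> 0 = 1 - x ^ (i + j + 1)"
    using assms by (subst pmf_geometric) (auto simp: power_less_one_iff simp del: power_Suc)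
  finally show ?thesis .
qed

lemma measure_cond_pmf:
  assumes "0 < measure_pmf.prob M S"
  shows "measure_pmf.prob (cond_pmf M S) A = measure_pmf.prob M (S \<inter> A) / measure_pmf.prob M S"
proof -
  have ne: "set_pmf M \<inter> S \<noteq> {}"
    using assms by (metis measure_pmf_zero_iff less_irrefl)
  show ?thesis
    using assms by (subst cond_pmf.rep_eq[OF ne])
      (simp add: measure_uniform_measure measure_pmf.emeasure_eq_measure)
qed

locale boxed_sampler =
  fixes a b :: nat
  assumes ab: "1 \<le> a" "1 \<le> b"
begin

sublocale weighted_cells "cells a b" cell_weight "(0, 0)"
  using ab by unfold_locales (auto simp: cell_weight_def)

lemma alpha_eq: "\<alpha> = a * b"
  by (simp add: \<alpha>_def)

lemma xi_eq: "xi a b n = tuned n"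
  by (simp add: xi_def tuned_def alpha_eq)

lemma prob_size:
  assumes "\<alpha> < n"
  shows "measure_pmf.prob (diagram_pmf a b (xi a b n)) {D. diagram_size D = m} = size_prob n m"
proof -
  note x = tuned_bounds[OF assms]
  have fin: "finite (weighted_solutions (cells a b) cell_weight m)"
    by (intro finite_weighted_solutions) auto
  have "measure_pmf.prob (diagram_pmf a b (tuned n)) {D. diagram_size D = m} =
      measure_pmf.prob (diagram_pmf a b (tuned n)) (weighted_solutions (cells a b) cell_weight m)"
    by (intro measure_prob_cong_0)
      (auto simp: weighted_solutions_cells pmf_diagram_pmf[OF x])
  also have "\<dots> = (\<Sum>D\<in>weighted_solutions (cells a b) cell_weight m. pmf (diagram_pmf a b (tuned n)) D)"
    by (rule measure_measure_pmf_finite[OF fin])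
  also have "\<dots> = (\<Sum>D\<in>weighted_solutions (cells a b) cell_weight m.
      tuned n ^ m * (\<Prod>c\<in>cells a b. 1 - tuned n ^ cell_weight c))"
    by (intro sum.cong) (auto simp: weighted_solutions_cells pmf_diagram_pmf[OF x])
  also have "\<dots> = size_prob n m"
    by (simp add: size_prob_def)
  finally show ?thesis by (simp add: xi_eq)
qed

lemma finite_size_window: "finite {m. real m \<in> size_window n \<epsilon>}"
  by (rule finite_subset[of _ "{..nat \<lceil>real n * (1 + \<epsilon>)\<rceil>}"])
    (auto simp: size_window_def le_nat_iff, linarith)

lemma prob_window:
  assumes "\<alpha> < n"
  shows "measure_pmf.prob (diagram_pmf a b (xi a b n)) {D. real (diagram_size D) \<in> size_window n \<epsilon>} =
    (\<Sum>m | real m \<in> size_window n \<epsilon>. size_prob n m)"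
proof -
  let ?M = "diagram_pmf a b (xi a b n)"
  have "measure_pmf.prob ?M {D. real (diagram_size D) \<in> size_window n \<epsilon>} =
      measure_pmf.prob (map_pmf diagram_size ?M) {m. real m \<in> size_window n \<epsilon>}"
    by (simp add: vimage_def)
  also have "\<dots> = (\<Sum>m | real m \<in> size_window n \<epsilon>. pmf (map_pmf diagram_size ?M) m)"
    by (rule measure_measure_pmf_finite[OF finite_size_window])
  also have "\<dots> = (\<Sum>m | real m \<in> size_window n \<epsilon>. size_prob n m)"
    by (intro sum.cong refl) (simp add: pmf_map vimage_def prob_size[OF assms])
  finally show ?thesis .
qed

lemma size_prob_pos:
  assumes "\<alpha> < n"
  shows "0 < size_prob n m"
proof -
  \<comment> \<open>The cell at the origin has weight 1, so putting \<open>m\<close> there gives a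
    diagram of size \<open>m\<close>: every size is attainable.\<close>
  have "(\<lambda>_. 0)((0, 0) := m) \<in> weighted_solutions (cells a b) cell_weight m"
    using ab by (auto simp: weighted_solutions_def sum.remove[of _ "(0, 0)"] cell_weight_def)
  moreover have "finite (weighted_solutions (cells a b) cell_weight m)"
    by (intro finite_weighted_solutions) auto
  ultimately have "0 < card (weighted_solutions (cells a b) cell_weight m)"
    by (auto simp: card_gt_0_iff)
  moreover have "0 < (\<Prod>c\<in>cells a b. 1 - tuned n ^ cell_weight c)"
    using tuned_bounds[OF assms] by (intro prod_pos) (auto simp: power_less_one_iff)
  ultimately show ?thesis
    using tuned_bounds[OF assms] unfolding size_prob_def by (intro mult_pos_pos) auto
qed

lemma size_prob_le_window:
  assumes "\<alpha> < n" "0 < \<epsilon>"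
  shows "size_prob n n \<le> (\<Sum>m | real m \<in> size_window n \<epsilon>. size_prob n m)"
proof (rule member_le_sum)
  have "real n * (1 - \<epsilon>) \<le> real n" "real n \<le> real n * (1 + \<epsilon>)"
    using assms(2) by (simp_all add: algebra_simps)
  then show "n \<in> {m. real m \<in> size_window n \<epsilon>}"
    by (simp add: size_window_def)
qed (use finite_size_window size_prob_pos[OF assms(1)] in \<open>auto intro: less_imp_le\<close>)

abbreviation conditioned :: "nat \<Rightarrow> (nat \<Rightarrow> bool) \<Rightarrow> array pmf" where
  "conditioned n P \<equiv> cond_pmf (diagram_pmf a b (xi a b n)) {D. P (diagram_size D)}"

context
  fixes n :: nat and P :: "nat \<Rightarrow> bool" and p :: real
  assumes n: "\<alpha> < n"
    and p: "measure_pmf.prob (diagram_pmf a b (xi a b n)) {D. P (diagram_size D)} = p" "0 < p"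
begin

lemma x01: "0 < xi a b n" "xi a b n < 1"
  using tuned_bounds[OF n] by (simp_all add: xi_eq)

lemma conditioned_support: "set_pmf (diagram_pmf a b (xi a b n)) \<inter> {D. P (diagram_size D)} \<noteq> {}"
  using p by (metis measure_pmf_zero_iff less_irrefl)

lemma set_conditioned: "set_pmf (conditioned n P) = {D. boxed a b D \<and> P (diagram_size D)}"
  using set_cond_pmf[OF conditioned_support] set_diagram_pmf[OF x01] by auto

lemma pmf_conditioned:
  "boxed a b D \<Longrightarrow> P (diagram_size D) \<Longrightarrow> pmf (conditioned n P) D =
    xi a b n ^ diagram_size D * (\<Prod>c\<in>cells a b. 1 - xi a b n ^ cell_weight c) / p"
  by (simp add: pmf_cond[OF conditioned_support] pmf_diagram_pmf[OF x01] p)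

text \<open>Stated for any acceptance rule on sizes with positive probability \<open>p\<close>, so
  that both samplers are instances.\<close>

lemma sample_partitions_facts:
  defines "S \<equiv> sample_partitions a b (xi a b n) P"
  shows "output_distribution S = spmf_of_pmf (map_pmf (pak_map a b) (conditioned n P))"
    and "finite_expected_cost S"
    and "expected_cost S = real (a * b) / p +
      measure_pmf.expectation (conditioned n P) (\<lambda>D. real (snd (pak_transform D)))"
proof -
  have K: "0 < a * b" using ab by simp
  have p': "0 < measure_pmf.prob (diagram_pmf a b (xi a b n)) {D. P (diagram_size D)}"
    using p by simp
  have bound: "real (snd (pak_transform D)) \<le> psi a b" if "D \<in> set_pmf (diagram_pmf a b (xi a b n))" for D
    using that snd_pak_transform_le by (simp add: set_diagram_pmf[OF x01])
  note facts = repeat_until_post[OF K p', of pak_transform "psi a b", OF bound]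
  show "finite_expected_cost S"
    using facts(2) by (simp add: S_def finite_expected_cost_def sample_partitions_def gamma_M_eq)
  show "expected_cost S = real (a * b) / p +
      measure_pmf.expectation (conditioned n P) (\<lambda>D. real (snd (pak_transform D)))"
    using facts(3) by (simp add: S_def expected_cost_def sample_partitions_def gamma_M_eq p(1))
  have "output_distribution S = spmf_of_pmf (map_pmf (fst \<circ> pak_transform) (conditioned n P))"
    using facts(1) by (simp add: S_def output_distribution_def sample_partitions_def gamma_M_eq)
  also have "map_pmf (fst \<circ> pak_transform) (conditioned n P) = map_pmf (pak_map a b) (conditioned n P)"
    by (intro map_pmf_cong) (auto simp: set_conditioned pak_transform_eq)
  finally show "output_distribution S = spmf_of_pmf (map_pmf (pak_map a b) (conditioned n P))" .
qed

lemma integrable_pak_cost: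
  "integrable (measure_pmf (conditioned n P)) (\<lambda>D. real (snd (pak_transform D)))"
  using snd_pak_transform_le
  by (intro measure_pmf.integrable_const_bound[where B = "psi a b"]) (auto simp: AE_measure_pmf_iff set_conditioned)

lemma pak_cost_expectation_bounds:
  "0 \<le> measure_pmf.expectation (conditioned n P) (\<lambda>D. real (snd (pak_transform D)))"
  "measure_pmf.expectation (conditioned n P) (\<lambda>D. real (snd (pak_transform D))) \<le> psi a b"
proof -
  show "measure_pmf.expectation (conditioned n P) (\<lambda>D. real (snd (pak_transform D))) \<le> psi a b"
    using snd_pak_transform_le
    by (intro measure_pmf.integral_le_const integrable_pak_cost) (auto simp: AE_measure_pmf_iff set_conditioned)
qed simp

text \<open>Unless the corner entry vanishes, the bounding rectangle is the whole box.\<close>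

lemma pak_cost_expectation_lower:
  "psi a b - psi a b * ((1 - xi a b n ^ (a + b - 1)) / p) \<le>
    measure_pmf.expectation (conditioned n P) (\<lambda>D. real (snd (pak_transform D)))"
proof -
  define Z where "Z = {D :: array. D (a - 1, b - 1) = 0}"
  have psi: "0 \<le> psi a b" by (metis pak_cost_eq_psi of_nat_0_le_iff)
  have integrable: "integrable (measure_pmf (conditioned n P)) (indicator Z :: array \<Rightarrow> real)"
    by (intro measure_pmf.integrable_const_bound[where B = 1]) auto
  have w: "a - 1 + (b - 1) + 1 = a + b - 1" using ab by simp
  have "measure_pmf.prob (diagram_pmf a b (xi a b n)) Z = 1 - xi a b n ^ (a + b - 1)"
    using measure_diagram_pmf_corner_zero[OF x01, of "a - 1" a "b - 1" b] ab unfolding w Z_def by simp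
  then have "measure_pmf.prob (diagram_pmf a b (xi a b n)) ({D. P (diagram_size D)} \<inter> Z)
      \<le> 1 - xi a b n ^ (a + b - 1)"
    using measure_pmf.finite_measure_mono[of "{D. P (diagram_size D)} \<inter> Z" Z "diagram_pmf a b (xi a b n)"]
    by simp
  \<comment> \<open>Conditioning inflates a probability by at most the factor
    \<open>1 / p\<close>.\<close>
  then have prob: "measure_pmf.prob (conditioned n P) Z \<le> (1 - xi a b n ^ (a + b - 1)) / p"
    using p by (subst measure_cond_pmf) (auto intro: divide_right_mono)
  have "psi a b - psi a b * ((1 - xi a b n ^ (a + b - 1)) / p) \<le>
      psi a b - psi a b * measure_pmf.prob (conditioned n P) Z"
    using mult_left_mono[OF prob psi] by simp
  also have "\<dots> = measure_pmf.expectation (conditioned n P) (\<lambda>D. psi a b - psi a b * indicator Z D)"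
    using integrable by (subst Bochner_Integration.integral_diff) auto
  also have "\<dots> \<le> measure_pmf.expectation (conditioned n P) (\<lambda>D. real (snd (pak_transform D)))"
  proof (intro integral_mono_AE integrable_pak_cost)
    show "AE D in measure_pmf (conditioned n P). psi a b - psi a b * indicator Z D \<le> real (snd (pak_transform D))"
      using snd_pak_transform_full[of a b]
      by (auto simp: AE_measure_pmf_iff set_conditioned indicator_def Z_def)
  qed (use integrable in auto)
  finally show ?thesis .
qed

end

section \<open>Laws of the outputs\<close>

lemma exact_sampler:
  assumes "\<alpha> < n"
  shows "exact_size_sampler a b n (output_distribution (sample_exact a b n))"
proof -
  define A where "A = {D. boxed a b D \<and> diagram_size D = n}"
  have A: "A = weighted_solutions (cells a b) cell_weight n"
    by (simp add: A_def weighted_solutions_cells)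
  have fin: "finite A" unfolding A by (intro finite_weighted_solutions) auto
  note p = prob_size[OF assms, of n] size_prob_pos[OF assms, of n]
  have set: "set_pmf (conditioned n (\<lambda>m. m = n)) = A"
    using set_conditioned[OF assms p] by (simp add: A_def)
  then have ne: "A \<noteq> {}" by (metis set_pmf_not_empty)
  have C: "conditioned n (\<lambda>m. m = n) = pmf_of_set A"
  proof (rule pmf_eqI)
    fix D
    show "pmf (conditioned n (\<lambda>m. m = n)) D = pmf (pmf_of_set A) D"
    proof (cases "D \<in> A")
      case True
      \<comment> \<open>\<open>z\<close> is the common mass of all boxed diagrams of size
        \<open>n\<close>, so conditioning leaves \<open>z / (card A * z)\<close> for each.\<close>
      define z where "z = tuned n ^ n * (\<Prod>c\<in>cells a b. 1 - tuned n ^ cell_weight c)"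
      have size: "size_prob n n = real (card A) * z"
        by (simp add: size_prob_def A z_def)
      have "pmf (conditioned n (\<lambda>m. m = n)) D = z / size_prob n n"
        using pmf_conditioned[OF assms p, of D] True by (simp add: z_def A_def xi_eq)
      then show ?thesis
        using p(2) True ne fin unfolding size by (auto simp: zero_less_mult_iff)
    next
      case False
      then show ?thesis using set ne fin by (simp add: set_pmf_iff[symmetric] pmf_eq_0_set_pmf)
    qed
  qed
  have bij: "bij_betw (pak_map a b) A {\<pi> \<in> boxed_plane_partitions a b. partition_size \<pi> = n}"
  proof (rule bij_betw_subset[OF bij_betw_pak_map])
    show "pak_map a b ` A = {\<pi> \<in> boxed_plane_partitions a b. partition_size \<pi> = n}"
      using bij_betw_apply[OF bij_betw_pak_map, of _ a b] pak_map_surj[of _ a b] partition_size_pak_map[of a b]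
      unfolding A_def by fastforce
  qed (auto simp: A_def)
  have "map_pmf (pak_map a b) (pmf_of_set A) = pmf_of_set {\<pi> \<in> boxed_plane_partitions a b. partition_size \<pi> = n}"
    by (rule map_pmf_of_set_bij_betw[OF bij ne fin])
  moreover have "finite {\<pi> \<in> boxed_plane_partitions a b. partition_size \<pi> = n}"
    "{\<pi> \<in> boxed_plane_partitions a b. partition_size \<pi> = n} \<noteq> {}"
    using bij_betw_finite[OF bij] fin bij ne by (auto simp: bij_betw_def)
  ultimately show ?thesis
    using sample_partitions_facts(1)[OF assms p]
    by (simp add: exact_size_sampler_def sample_exact_def C)
qed

text \<open>Conditioned masses depend only on the diagram size, and the transform is injective and
  preserves size, so they pass unchanged to the partitions.\<close>

lemma approx_sampler:
  assumes "\<alpha> < n" "0 < \<epsilon>"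
  shows "approx_size_sampler a b n \<epsilon> (output_distribution (sample_approx a b n \<epsilon>))"
proof -
  let ?P = "\<lambda>m. real m \<in> size_window n \<epsilon>"
  define C where "C = conditioned n ?P"
  have pos: "0 < (\<Sum>m | real m \<in> size_window n \<epsilon>. size_prob n m)"
    using size_prob_le_window[OF assms] size_prob_pos[OF assms(1), of n] by linarith
  note p = prob_window[OF assms(1), of \<epsilon>] pos
  have out: "output_distribution (sample_approx a b n \<epsilon>) = spmf_of_pmf (map_pmf (pak_map a b) C)"
    unfolding sample_approx_def C_def by (rule sample_partitions_facts(1)[OF assms(1) p])
  have set: "set_pmf C = {D. boxed a b D \<and> ?P (diagram_size D)}"
    unfolding C_def by (rule set_conditioned[OF assms(1) p])
  have inj: "inj_on (pak_map a b) (set_pmf C)"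
    using bij_betw_imp_inj_on[OF bij_betw_pak_map] unfolding set by (rule inj_on_subset) auto
  have "pmf (map_pmf (pak_map a b) C) \<pi> = pmf (map_pmf (pak_map a b) C) \<rho>"
    if \<pi>\<rho>: "\<pi> \<in> boxed_plane_partitions a b" "\<rho> \<in> boxed_plane_partitions a b"
      "?P (partition_size \<pi>)" "partition_size \<pi> = partition_size \<rho>" for \<pi> \<rho>
  proof -
    obtain D E where DE: "boxed a b D" "pak_map a b D = \<pi>" "boxed a b E" "pak_map a b E = \<rho>"
      using pak_map_surj \<pi>\<rho>(1,2) by metis
    then have sizes: "diagram_size D = partition_size \<pi>" "diagram_size E = partition_size \<pi>"
      using partition_size_pak_map \<pi>\<rho>(4) by metis+
    then have "D \<in> set_pmf C" "E \<in> set_pmf C" using DE \<pi>\<rho>(3) by (auto simp: set)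
    moreover have "pmf C D = pmf C E"
      using pmf_conditioned[OF assms(1) p, of D] pmf_conditioned[OF assms(1) p, of E] DE sizes \<pi>\<rho>(3)
      by (simp add: C_def)
    ultimately show ?thesis
      using pmf_map_inj[OF inj] DE by metis
  qed
  moreover have "pak_map a b ` set_pmf C \<subseteq>
      {\<pi> \<in> boxed_plane_partitions a b. ?P (partition_size \<pi>)}"
    using bij_betw_apply[OF bij_betw_pak_map, of _ a b] partition_size_pak_map[of a b] by (auto simp: set)
  ultimately show ?thesis
    unfolding approx_size_sampler_def out Let_def by simp
qed

section \<open>Limits of the expected running times\<close>

lemma exact_cost:
  "(\<lambda>n. expected_cost (sample_exact a b n)) \<sim>[at_top] (\<lambda>n. real (a * b) / phi (real (a * b)) * real n)"
proof -
  define E where "E n = measure_pmf.expectation (conditioned n (\<lambda>m. m = n)) (\<lambda>D. real (snd (pak_transform D)))" for n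
  have cost: "expected_cost (sample_exact a b n) = real \<alpha> / size_prob n n + E n" if "\<alpha> < n" for n
    using sample_partitions_facts(3)[OF that prob_size[OF that, of n] size_prob_pos[OF that, of n]]
    by (simp add: sample_exact_def E_def alpha_eq)
  have E: "0 \<le> E n" "E n \<le> psi a b" if "\<alpha> < n" for n
    using pak_cost_expectation_bounds[OF that prob_size[OF that, of n] size_prob_pos[OF that, of n]]
    by (simp_all add: E_def)
  have "\<forall>\<^sub>F n in sequentially. real n / real n = 1"
    using eventually_gt_at_top[of 0] by eventually_elim simp
  \<comment> \<open>The choice \<open>m n = n\<close> in the local limit gives \<open>u = 1\<close>,
    where the density is \<open>phi \<alpha>\<close>.\<close>
  then have "(\<lambda>n. real n / real n) \<longlonglongrightarrow> 1"
    by (rule tendsto_eventually)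
  from local_limit[OF this] have P: "(\<lambda>n. real n * size_prob n n) \<longlonglongrightarrow> phi (real \<alpha>)" by simp
  have E0: "(\<lambda>n. E n / real n) \<longlonglongrightarrow> 0"
  proof (rule tendsto_sandwich)
    show "\<forall>\<^sub>F n in sequentially. 0 \<le> E n / real n"
      using eventually_gt_at_top[of \<alpha>] by eventually_elim (simp add: E)
    show "\<forall>\<^sub>F n in sequentially. E n / real n \<le> psi a b / real n"
      using eventually_gt_at_top[of \<alpha>] by eventually_elim (simp add: E divide_right_mono)
    show "(\<lambda>n. psi a b / real n) \<longlonglongrightarrow> 0" by (rule lim_const_over_n)
  qed simp
  \<comment> \<open>This is the ratio of the cost to its claimed equivalent, arranged into
    convergent terms; the transform enters only through \<open>E n / n\<close>.\<close>
  have "(\<lambda>n. phi (real \<alpha>) / (real n * size_prob n n) + E n / real n * (phi (real \<alpha>) / real \<alpha>))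
      \<longlonglongrightarrow> phi (real \<alpha>) / phi (real \<alpha>) + 0 * (phi (real \<alpha>) / real \<alpha>)"
    using phi_alpha_pos by (intro tendsto_intros P E0) auto
  then have lim: "(\<lambda>n. phi (real \<alpha>) / (real n * size_prob n n) + E n / real n * (phi (real \<alpha>) / real \<alpha>)) \<longlonglongrightarrow> 1"
    using phi_alpha_pos by simp
  have "(\<lambda>n. expected_cost (sample_exact a b n) / (real \<alpha> / phi (real \<alpha>) * real n)) \<longlonglongrightarrow> 1"
  proof (rule Lim_transform_eventually[OF lim])
    show "\<forall>\<^sub>F n in sequentially. phi (real \<alpha>) / (real n * size_prob n n) + E n / real n * (phi (real \<alpha>) / real \<alpha>) =
      expected_cost (sample_exact a b n) / (real \<alpha> / phi (real \<alpha>) * real n)"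
      using eventually_gt_at_top[of \<alpha>]
    proof eventually_elim
      case (elim n)
      then show ?case
        using alpha_pos phi_alpha_pos size_prob_pos[OF elim, of n]
        by (simp add: cost field_simps)
    qed
  qed
  then show ?thesis
    unfolding alpha_eq by (rule asymp_equivI')
qed

text \<open>The acceptance probability has a positive limit, so the probability of a vanishing
  corner still tends to 0 after division by it, and the two bounds on the transform cost meet at
  \<open>psi a b\<close>. For exact size both quantities are of order \<open>1 / n\<close>, and this
  argument would be inconclusive.\<close>

lemma approx_cost:
  assumes \<epsilon>: "0 < \<epsilon>" "\<epsilon> < 1"
  shows "(\<lambda>n. expected_cost (sample_approx a b n \<epsilon>)) \<longlonglongrightarrow>
    psi a b + real (a * b) / Phi (real (a * b)) \<epsilon>"
proof -
  let ?P = "\<lambda>n m. real m \<in> size_window n \<epsilon>"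
  define p where "p n = (\<Sum>m | real m \<in> size_window n \<epsilon>. size_prob n m)" for n
  define E where "E n = measure_pmf.expectation (conditioned n (?P n)) (\<lambda>D. real (snd (pak_transform D)))" for n
  have prob: "measure_pmf.prob (diagram_pmf a b (xi a b n)) {D. ?P n (diagram_size D)} = p n" "0 < p n" if "\<alpha> < n" for n
    using prob_window[OF that] size_prob_le_window[OF that \<epsilon>(1)] size_prob_pos[OF that, of n]
    unfolding p_def by auto
  have cost: "real \<alpha> / p n + E n = expected_cost (sample_approx a b n \<epsilon>)" if "\<alpha> < n" for n
    using sample_partitions_facts(3)[OF that prob[OF that]]
    by (simp add: sample_approx_def E_def alpha_eq)
  have P: "p \<longlonglongrightarrow> Phi (real \<alpha>) \<epsilon>"
    unfolding p_def[abs_def] by (rule window_limit[OF \<epsilon>])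
  note Phi = Phi_alpha_pos[OF \<epsilon>]
  have "E \<longlonglongrightarrow> psi a b"
  proof (rule tendsto_sandwich)
    show "\<forall>\<^sub>F n in sequentially. E n \<le> psi a b"
      using eventually_gt_at_top[of \<alpha>]
    proof eventually_elim
      case (elim n)
      then show ?case
        using pak_cost_expectation_bounds(2)[OF elim prob[OF elim]] by (simp add: E_def)
    qed
    show "\<forall>\<^sub>F n in sequentially. psi a b - psi a b * ((1 - tuned n ^ (a + b - 1)) / p n) \<le> E n"
      using eventually_gt_at_top[of \<alpha>]
    proof eventually_elim
      case (elim n)
      then show ?case
        using pak_cost_expectation_lower[OF elim prob[OF elim]] by (simp add: E_def xi_eq)
    qed
    have "(\<lambda>n. psi a b - psi a b * ((1 - tuned n ^ (a + b - 1)) / p n)) \<longlonglongrightarrow>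
        psi a b - psi a b * ((1 - 1 ^ (a + b - 1)) / Phi (real \<alpha>) \<epsilon>)"
      using Phi by (intro tendsto_intros P tendsto_tuned) auto
    then show "(\<lambda>n. psi a b - psi a b * ((1 - tuned n ^ (a + b - 1)) / p n)) \<longlonglongrightarrow> psi a b"
      by simp
  qed simp
  then have "(\<lambda>n. real \<alpha> / p n + E n) \<longlonglongrightarrow> real \<alpha> / Phi (real \<alpha>) \<epsilon> + psi a b"
    using Phi by (intro tendsto_intros P) auto
  moreover have "\<forall>\<^sub>F n in sequentially. real \<alpha> / p n + E n = expected_cost (sample_approx a b n \<epsilon>)"
    using eventually_gt_at_top[of \<alpha>] by eventually_elim (rule cost)
  ultimately show ?thesis
    by (simp add: Lim_transform_eventually alpha_eq add.commute)
qed

lemma finite_expected_costs: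
  assumes "\<alpha> < n"
  shows "finite_expected_cost (sample_exact a b n)"
    and "0 < \<epsilon> \<Longrightarrow> finite_expected_cost (sample_approx a b n \<epsilon>)"
proof -
  show "finite_expected_cost (sample_exact a b n)"
    unfolding sample_exact_def
    by (rule sample_partitions_facts(2)[OF assms prob_size[OF assms] size_prob_pos[OF assms]])
  assume "0 < \<epsilon>"
  then have "0 < (\<Sum>m | real m \<in> size_window n \<epsilon>. size_prob n m)"
    using size_prob_le_window[OF assms, of \<epsilon>] size_prob_pos[OF assms, of n] by linarith
  then show "finite_expected_cost (sample_approx a b n \<epsilon>)"
    unfolding sample_approx_def
    by (rule sample_partitions_facts(2)[OF assms prob_window[OF assms]])
qed

end

theorem theorem10:
  fixes a b :: nat
  assumes "1 \<le> a" and "1 \<le> b"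
  shows
    "(\<forall>n > a * b. exact_size_sampler a b n (output_distribution (sample_exact a b n)) \<and>
        finite_expected_cost (sample_exact a b n)) \<and>
     (\<lambda>n. expected_cost (sample_exact a b n))
       \<sim>[at_top] (\<lambda>n. real (a * b) / phi (real (a * b)) * real n) \<and>
     (\<forall>\<epsilon>::real. 0 < \<epsilon> \<and> \<epsilon> < 1 \<longrightarrow>
        (\<forall>n > a * b. approx_size_sampler a b n \<epsilon> (output_distribution (sample_approx a b n \<epsilon>)) \<and>
           finite_expected_cost (sample_approx a b n \<epsilon>)) \<and>
        ((\<lambda>n. expected_cost (sample_approx a b n \<epsilon>))
           \<longlonglongrightarrow> psi a b + real (a * b) / Phi (real (a * b)) \<epsilon>))"
proof -
  interpret boxed_sampler a b
    using assms by unfold_locales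
  show ?thesis
    using exact_sampler approx_sampler exact_cost approx_cost finite_expected_costs
    by (auto simp: alpha_eq)
qed

end
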